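(* Let $N\geq 2$, $1\leq d<N$ be integers, $0<p<q\leq\infty$ and $s>\sigma_p$. Then there exists a function $f\in B_{p,q}^s(\mathbb{R}^N)$ such that $$f(\cdot,y)\notin B_{p,\infty}^{s}(\mathbb{R}^d)\qquad\text{for a.e. } y\in\mathbb{R}^{N-d}.$$
   Context: $\sigma_p:=N\left(\frac1p-1\right)_+$ with $x_+=\max\{0,x\}$. Points of $\mathbb{R}^N$ are written $(x,y)$ with $x\in\mathbb{R}^d$, $y\in\mathbb{R}^{N-d}$, and $f(\cdot,y)$ is the function $x\mapsto f(x,y)$ on $\mathbb{R}^d$. For $M\in\{1,2,\dots\}$ and $h\in\mathbb{R}^n$, $\Delta_h^Mf(x)=\sum_{j=0}^M(-1)^{M-j}\binom{M}{j}f(x+hj)$. For $n\geq1$, $0<p,q\leq\infty$, $s>n(\frac1p-1)_+$ with $s>0$, and an integer $M>s$, the Besov space $B_{p,q}^s(\mathbb{R}^n)$ is the set of all $f\in L^p(\mathbb{R}^n)$ with $$[f]_{B_{p,q}^s(\mathbb{R}^n)}:=\left(\int_{|h|\leq1}\|\Delta_h^Mf\|_{L^p(\mathbb{R}^n)}^q\frac{\mathrm{d}h}{|h|^{n+sq}}\right)^{1/q}<\infty,$$ which for $q=\infty$ means $\sup_{0<|h|\leq1}|h|^{-s}\|\Delta_h^Mf\|_{L^p(\mathbb{R}^n)}<\infty$. Different choices of $M>s$ give the same space with equivalent quasi-norms $\|f\|_{L^p}+[f]_{B_{p,q}^s}$. *)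

theory Defs
  imports "HOL-Analysis.Analysis" "HOL-Probability.Essential_Supremum"
begin

definition sigma_exp :: "nat \<Rightarrow> ennreal \<Rightarrow> real" where
  "sigma_exp n p = real n * max 0 (enn2real (1 / p) - 1)"

text \<open>Real powers on \<open>[0, \<infinity>]\<close>; intended for exponents \<open>a > 0\<close>, so that \<open>\<infinity>\<close> to the power
  \<open>a\<close> is \<open>\<infinity>\<close>.\<close>

definition ennpowr :: "ennreal \<Rightarrow> real \<Rightarrow> ennreal" where
  "ennpowr x a = (if x = \<infinity> then \<infinity> else ennreal (enn2real x powr a))"

text \<open>Integrals, measurability and "almost everywhere" all refer to the Lebesgue measure
  (the completion of \<^const>\<open>lborel\<close>), so that modifying a function on a null set changes neither
  its measurability nor its norms.\<close>

definition Lp_norm :: "ennreal \<Rightarrow> ('a::euclidean_space \<Rightarrow> real) \<Rightarrow> ennreal" where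
  "Lp_norm p f =
    (if p = \<infinity> then esssup lebesgue (\<lambda>x. ennreal \<bar>f x\<bar>)
     else ennpowr (\<integral>\<^sup>+x. ennreal (\<bar>f x\<bar> powr enn2real p) \<partial>lebesgue) (1 / enn2real p))"

definition Lp_space :: "ennreal \<Rightarrow> ('a::euclidean_space \<Rightarrow> real) set" where
  "Lp_space p = {f \<in> borel_measurable lebesgue. Lp_norm p f < \<infinity>}"

definition diff_op :: "nat \<Rightarrow> 'a::real_vector \<Rightarrow> ('a \<Rightarrow> real) \<Rightarrow> 'a \<Rightarrow> real" where
  "diff_op M h f x = (\<Sum>j=0..M. (-1) ^ (M - j) * real (M choose j) * f (x + real j *\<^sub>R h))"

text \<open>The order \<open>M\<close> of the differences is a parameter of the seminorm and of the space; it is meant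
  to be any integer \<open>M > s\<close>. For \<open>q < \<infinity>\<close> the point \<open>h = 0\<close> is a null set.\<close>

definition besov_seminorm ::
    "nat \<Rightarrow> real \<Rightarrow> ennreal \<Rightarrow> ennreal \<Rightarrow> ('a::euclidean_space \<Rightarrow> real) \<Rightarrow> ennreal" where
  "besov_seminorm M s p q f =
    (if q = \<infinity>
     then (SUP h\<in>{h::'a. 0 < norm h \<and> norm h \<le> 1}.
             ennreal (norm h powr (- s)) * Lp_norm p (diff_op M h f))
     else ennpowr
       (\<integral>\<^sup>+h\<in>{h::'a. norm h \<le> 1}.
          (ennpowr (Lp_norm p (diff_op M h f)) (enn2real q)
             / ennreal (norm h powr (real DIM('a) + s * enn2real q))) \<partial>lebesgue)
       (1 / enn2real q))"

definition besov_space ::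
    "nat \<Rightarrow> real \<Rightarrow> ennreal \<Rightarrow> ennreal \<Rightarrow> ('a::euclidean_space \<Rightarrow> real) set" where
  "besov_space M s p q = {f \<in> Lp_space p. besov_seminorm M s p q f < \<infinity>}"

end

theory Submission
  imports Defs
begin

text \<open>Write \<open>n = N - d\<close>. The function is a sum of atoms with disjoint supports,
\<open>f\<^sub>k(x, y) = a\<^sub>k \<lambda>\<^sub>k\<^bsup>d/p - s\<^esup> \<Psi>(\<lambda>\<^sub>k (x - x\<^sub>k)) \<Phi>((y - y\<^sub>k) / r\<^sub>k)\<close>,
where \<open>\<Psi>\<close> and \<open>\<Phi>\<close> are \<open>C\<^sup>M\<close> bumps on unit cubes, the frequencies \<open>\<lambda>\<^sub>k\<close> at least double from one
index to the next, \<open>r\<^sub>k \<le> 1\<close> and \<open>\<lambda>\<^sub>k \<ge> 1 / r\<^sub>k\<close>. The atom lives at frequency \<open>\<lambda>\<^sub>k\<close> both on the whole space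
and on its slices, so that no smoothness is lost by freezing \<open>y\<close>; what changes is the size. On the
whole space the contribution of \<open>f\<^sub>k\<close> to \<open>|h|\<^sup>-\<^sup>s \<parallel>\<Delta>\<^sub>h\<^sup>M f\<parallel>\<^sub>p\<close>, raised to the power \<open>p\<close>, is at most of the
order of the weight \<open>w\<^sub>k = a\<^sub>k\<^sup>p r\<^sub>k\<^sup>n\<close>, because the support in \<open>y\<close> has volume \<open>r\<^sub>k\<^sup>n\<close>. On a slice through
the middle of the cube \<open>y\<^sub>k + [0, r\<^sub>k]\<^sup>n\<close> it is of the order of \<open>a\<^sub>k\<^sup>p\<close>.

Hence it suffices that \<open>\<Sum>\<^sub>k w\<^sub>k\<^sup>\<rho> < \<infinity>\<close> for \<open>\<rho> = q / p\<close> while every \<open>y\<close> lies in the middle of cubes with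
arbitrarily large \<open>a\<^sub>k\<close>. This is where \<open>q > p\<close> enters: about \<open>(m L)\<^sup>n\<close> cubes of side \<open>1 / L\<close> and height
\<open>m\<close> cover a box of side of order \<open>m\<close>, and they contribute about \<open>(m L)\<^sup>n (m\<^sup>p L\<^sup>-\<^sup>n)\<^sup>\<rho>\<close> to the sum, which tends to zero as
\<open>L\<close> grows exactly when \<open>\<rho> > 1\<close> (\<open>recurrent_cubes_exist\<close>). For \<open>q = \<infinity>\<close> only boundedness of the
weights matters, and \<open>\<rho> = 2\<close> serves.

The points \<open>x\<^sub>k\<close> are so far apart that for \<open>|h| \<le> 1\<close> at most one atom is seen by the difference at
a given point (\<open>diff_op_example\<close>), so for every \<open>p\<close>, below or above \<open>1\<close>, the \<open>p\<close>-th powers of the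
norms of the atoms simply add up. One atom satisfies
\<open>\<parallel>\<Delta>\<^sub>h\<^sup>M f\<^sub>k\<parallel>\<^sub>p\<^sup>p \<le> C w\<^sub>k \<lambda>\<^sub>k\<^sup>-\<^sup>s\<^sup>p min(1, \<lambda>\<^sub>k |h|)\<^sup>M\<^sup>p\<close> (\<open>atom_diff_integral\<close>), which is \<open>|h|\<^sup>s\<^sup>p w\<^sub>k\<close> times a quantity
decaying like a power of \<open>min(t, 1 / t)\<close> in \<open>t = \<lambda>\<^sub>k |h|\<close>, as \<open>0 < s < M\<close>. Such quantities are
summable with a uniform bound both over \<open>k\<close> and over the dyadic shells of \<open>h\<close>
(\<open>suminf_decay_le\<close>), and the seminorm is controlled by a discrete Schur test
(\<open>ennpowr_suminf_le\<close>, \<open>suminf_shell_sum\<close>). For the slices, the step \<open>h = e / \<lambda>\<^sub>k\<close> in a coordinate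
direction \<open>e\<close> moves the atom off its own support, and the difference is at least as large as the
atom itself (\<open>slice_diff_integral\<close>).\<close>

section \<open>Finite differences and a compactly supported profile\<close>

lemma diff_op_0: "diff_op 0 h F x = F x"
  by (simp add: diff_op_def)

text \<open>With this recursion, in its outer or inner form, estimates for differences go by induction on the
order instead of through the alternating binomial sum.\<close>

lemma diff_op_Suc: "diff_op (Suc m) h F x = diff_op m h F (x + h) - diff_op m h F x"
proof -
  define g where "g j = - ((-1) ^ (m - j) * real (m choose j) * F (x + real j *\<^sub>R h))" for j
  have "diff_op m h F x = - sum g {0..m}"
    by (simp add: diff_op_def g_def sum_negf)
  also have "sum g {0..m} = sum g {0..Suc m}"
    by (simp add: g_def)
  also have "sum g {0..Suc m} = g 0 + (\<Sum>j=0..m. g (Suc j))"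
    by (simp only: sum.atLeast0_atMost_Suc_shift o_def)
  also have "(\<Sum>j=0..m. g (Suc j)) =
      (\<Sum>j=0..m. (-1) ^ (m - j) * real (m choose Suc j) * F (x + real (Suc j) *\<^sub>R h))"
  proof (rule sum.cong[OF refl])
    fix j assume j: "j \<in> {0..m}"
    show "g (Suc j) = (-1) ^ (m - j) * real (m choose Suc j) * F (x + real (Suc j) *\<^sub>R h)"
    proof (cases "j = m")
      case False
      then have "m - j = Suc (m - Suc j)" using j by auto
      then show ?thesis by (simp add: g_def)
    qed (simp add: g_def)
  qed
  finally have 1: "- diff_op m h F x = g 0 +
      (\<Sum>j=0..m. (-1) ^ (m - j) * real (m choose Suc j) * F (x + real (Suc j) *\<^sub>R h))" by simp
  have "diff_op (Suc m) h F x = g 0 +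
      (\<Sum>j=0..m. (-1) ^ (m - j) * real (Suc m choose Suc j) * F (x + real (Suc j) *\<^sub>R h))"
    unfolding diff_op_def sum.atLeast0_atMost_Suc_shift by (simp add: g_def o_def)
  also have "\<dots> = g 0 + (\<Sum>j=0..m. (-1) ^ (m - j) * real (m choose Suc j) * F (x + real (Suc j) *\<^sub>R h))
      + diff_op m h F (x + h)"
    by (simp add: diff_op_def algebra_simps sum.distrib)
  finally show ?thesis using 1 by simp
qed

lemma diff_op_Suc_inner: "diff_op (Suc m) h F x = diff_op m h (\<lambda>x. F (x + h) - F x) x"
  unfolding diff_op_Suc by (simp add: diff_op_def algebra_simps sum_subtractf)

lemma diff_op_add: "diff_op m h (\<lambda>x. F x + G x) x = diff_op m h F x + diff_op m h G x"
  by (simp add: diff_op_def algebra_simps sum.distrib)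

lemma diff_op_cmult: "diff_op m h (\<lambda>x. c * F x) x = c * diff_op m h F x"
  by (simp add: diff_op_def sum_distrib_left mult_ac)

lemma diff_op_translate: "diff_op m h (\<lambda>x. F (x + v)) x = diff_op m h F (x + v)"
  by (simp add: diff_op_def algebra_simps)

lemma diff_op_affine:
  assumes "\<And>z. l (z + h) = l z + e"
  shows "diff_op m h (\<lambda>z. F (l z)) z = diff_op m e F (l z)"
proof (induction m arbitrary: z)
  case 0 then show ?case by (simp add: diff_op_0)
next
  case (Suc m) then show ?case by (simp add: diff_op_Suc assms)
qed

text \<open>A substitute for the Leibniz formula that avoids writing it out: one difference of a product is
\<open>\<Delta>F \<cdot> G(\<cdot> + h) + F \<cdot> \<Delta>G\<close>, and the bounds on the factors are stable under both operations, at the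
price of a factor \<open>2\<close> for each order. The number \<open>c\<close> plays the part of the size of the step.\<close>

lemma diff_op_mult_le:
  fixes F G :: "'a::real_vector \<Rightarrow> real"
  assumes "\<And>i z. i \<le> m \<Longrightarrow> \<bar>diff_op i h F z\<bar> \<le> A * c ^ i"
    and "\<And>i z. i \<le> m \<Longrightarrow> \<bar>diff_op i h G z\<bar> \<le> B * c ^ i"
  shows "\<bar>diff_op m h (\<lambda>z. F z * G z) z\<bar> \<le> 2 ^ m * A * B * c ^ m"
  using assms
proof (induction m arbitrary: F G A B z)
  case 0
  have "\<bar>F z\<bar> \<le> A" "\<bar>G z\<bar> \<le> B" using 0(1)[of 0 z] 0(2)[of 0 z] by (auto simp: diff_op_0)
  then show ?case by (simp add: diff_op_0 abs_mult mult_mono')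
next
  case (Suc m)
  have 1: "\<bar>diff_op m h (\<lambda>z. (F (z + h) - F z) * G (z + h)) z\<bar> \<le> 2 ^ m * (A * c) * B * c ^ m"
    using Suc.prems(1)[of "Suc i" for i] Suc.prems(2)
    by (intro Suc.IH) (auto simp: diff_op_translate diff_op_Suc_inner mult_ac)
  have 2: "\<bar>diff_op m h (\<lambda>z. F z * (G (z + h) - G z)) z\<bar> \<le> 2 ^ m * A * (B * c) * c ^ m"
    using Suc.prems(2)[of "Suc i" for i] Suc.prems(1)
    by (intro Suc.IH) (auto simp: diff_op_translate diff_op_Suc_inner mult_ac)
  have "diff_op (Suc m) h (\<lambda>z. F z * G z) z =
      diff_op m h (\<lambda>z. (F (z + h) - F z) * G (z + h) + F z * (G (z + h) - G z)) z"
    unfolding diff_op_Suc_inner by (simp add: algebra_simps)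
  also have "\<dots> = diff_op m h (\<lambda>z. (F (z + h) - F z) * G (z + h)) z +
      diff_op m h (\<lambda>z. F z * (G (z + h) - G z)) z"
    by (rule diff_op_add)
  finally show ?case using 1 2 by (simp add: algebra_simps)
qed

lemma diff_op_prod_le:
  fixes F :: "'i \<Rightarrow> 'a::real_vector \<Rightarrow> real"
  assumes "finite I" and "c \<ge> 0"
    and bd: "\<And>b i z. b \<in> I \<Longrightarrow> i \<le> M \<Longrightarrow> \<bar>diff_op i h (F b) z\<bar> \<le> K * c ^ i"
    and "m \<le> M"
  shows "\<bar>diff_op m h (\<lambda>z. \<Prod>b\<in>I. F b z) z\<bar> \<le> (2 ^ M * K) ^ card I * c ^ m"
  using assms(1,3,4)
proof (induction I arbitrary: m z rule: finite_induct)
  case empty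
  show ?case
    using \<open>c \<ge> 0\<close> by (cases m) (auto simp: diff_op_Suc_inner diff_op_0, simp add: diff_op_def)
next
  case (insert b I)
  have K: "K \<ge> 0" using insert.prems(1)[of b 0 z] by auto
  have "\<bar>diff_op m h (\<lambda>z. F b z * (\<Prod>b\<in>I. F b z)) z\<bar> \<le>
     2 ^ m * K * (2 ^ M * K) ^ card I * c ^ m"
    using insert.prems by (intro diff_op_mult_le insert.IH) auto
  also have "\<dots> \<le> 2 ^ M * K * (2 ^ M * K) ^ card I * c ^ m"
    using K \<open>c \<ge> 0\<close> insert.prems by (intro mult_right_mono power_increasing) auto
  finally show ?case using insert.hyps by (simp add: mult_ac)
qed

text \<open>Each difference is traded for a derivative and a factor \<open>e\<close> by the mean value inequality. The
functions \<open>F i\<close> are the successive derivatives of \<open>F 0\<close>.\<close>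

lemma diff_op_le_deriv:
  fixes F :: "nat \<Rightarrow> real \<Rightarrow> real"
  assumes deriv: "\<And>i t. i < M \<Longrightarrow> (F i has_real_derivative F (Suc i) t) (at t)"
    and bd: "\<And>i t. i \<le> M \<Longrightarrow> \<bar>F i t\<bar> \<le> K"
    and "i + m \<le> M"
  shows "\<bar>diff_op m e (F i) t\<bar> \<le> K * \<bar>e\<bar> ^ m"
  using \<open>i + m \<le> M\<close>
proof (induction m arbitrary: i t)
  case 0 then show ?case using bd by (simp add: diff_op_0)
next
  case (Suc m)
  have d: "(diff_op m e (F i) has_real_derivative diff_op m e (F (Suc i)) u) (at u)" for u
  proof -
    have "((\<lambda>u. F i (u + v)) has_real_derivative F (Suc i) (u + v)) (at u)" for v
      using deriv[of i "u+v"] Suc.prems by (simp add: DERIV_shift)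
    then show ?thesis unfolding diff_op_def by (auto intro!: derivative_eq_intros sum.cong)
  qed
  have "norm (diff_op m e (F i) (t + e) - diff_op m e (F i) t) \<le> (K * \<bar>e\<bar> ^ m) * norm ((t + e) - t)"
    by (rule field_differentiable_bound[of UNIV _ "diff_op m e (F (Suc i))"])
       (use d Suc.IH[of "Suc i"] Suc.prems in \<open>auto\<close>)
  then show ?case by (simp add: diff_op_Suc mult_ac)
qed

lemma diff_op_le_sup:
  assumes "\<And>t. \<bar>F t\<bar> \<le> (K::real)"
  shows "\<bar>diff_op m e F t\<bar> \<le> 2 ^ m * K"
proof (induction m arbitrary: t)
  case 0 then show ?case using assms by (simp add: diff_op_0)
next
  case (Suc m)
  show ?case using Suc[of t] Suc[of "t + e"] by (simp add: diff_op_Suc)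
qed

lemma pderiv_funpow_dvd:
  fixes u p :: "real poly"
  assumes "u ^ (n + k) dvd p"
  shows "u ^ n dvd (pderiv ^^ k) p"
  using assms
proof (induction k arbitrary: n)
  case (Suc k)
  have "u ^ Suc n dvd (pderiv ^^ k) p" using Suc.IH[of "Suc n"] Suc.prems by simp
  then obtain g where "(pderiv ^^ k) p = u ^ Suc n * g" by (elim dvdE)
  then have "(pderiv ^^ Suc k) p = pderiv (u ^ Suc n * g)" by simp
  also have "\<dots> = u ^ n * (u * pderiv g + smult (of_nat (Suc n)) (pderiv u) * g)"
    by (simp only: pderiv_mult pderiv_power_Suc) (simp add: algebra_simps)
  finally show ?case by simp
qed simp

text \<open>What the construction needs of a profile: it is supported in \<open>[0, 1]\<close>, bounded below on
\<open>[1/4, 3/4]\<close>, and its differences of order \<open>m \<le> M\<close> behave like those of a \<open>C\<^sup>M\<close> function for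
small steps and of a bounded function for large ones.\<close>

locale cutoff =
  fixes M :: nat and \<psi> :: "real \<Rightarrow> real" and K c :: real
  assumes c_pos: "c > 0"
    and cutoff_borel: "\<psi> \<in> borel_measurable borel"
    and cutoff_support: "t \<notin> {0..1} \<Longrightarrow> \<psi> t = 0"
    and cutoff_core: "t \<in> {1/4..3/4} \<Longrightarrow> \<psi> t \<ge> c"
    and cutoff_diff: "m \<le> M \<Longrightarrow> \<bar>diff_op m e \<psi> t\<bar> \<le> K * min 1 \<bar>e\<bar> ^ m"

text \<open>The \<open>i\<close>-th derivative of \<open>(t (1 - t))\<^bsup>M + 1\<^esup>\<close>, cut off outside \<open>[0, 1]\<close>. All derivatives of order up
to \<open>M\<close> vanish at both end points, so that cutting off and differentiating commute up to that order.\<close>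

definition hump :: "nat \<Rightarrow> nat \<Rightarrow> real \<Rightarrow> real" where
  "hump M i t = (if t \<in> {0..1} then poly ((pderiv ^^ i) ([:0, 1, -1:] ^ Suc M)) t else 0)"

lemma hump_zero: "i \<le> M \<Longrightarrow> poly ((pderiv ^^ i) ([:0, 1, -1:] ^ Suc M)) (0::real) = 0"
  "i \<le> M \<Longrightarrow> poly ((pderiv ^^ i) ([:0, 1, -1:] ^ Suc M)) (1::real) = 0"
proof -
  assume "i \<le> M"
  then have "([:0, 1, -1:]::real poly) ^ (1 + i) dvd [:0, 1, -1:] ^ Suc M"
    by (intro le_imp_power_dvd) auto
  from pderiv_funpow_dvd[OF this]
  obtain g where g: "(pderiv ^^ i) ([:0, 1, -1:] ^ Suc M) = ([:0, 1, -1:]::real poly) * g"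
    by (auto elim: dvdE)
  show "poly ((pderiv ^^ i) ([:0, 1, -1:] ^ Suc M)) (0::real) = 0"
    "poly ((pderiv ^^ i) ([:0, 1, -1:] ^ Suc M)) (1::real) = 0"
    unfolding g by simp_all
qed

lemma hump_deriv:
  assumes "i < M"
  shows "(hump M i has_real_derivative hump M (Suc i) t) (at t)"
proof -
  let ?p = "(pderiv ^^ i) ([:0, 1, -1:] ^ Suc M) :: real poly"
  have z: "poly ?p 0 = 0" "poly ?p 1 = 0" "poly (pderiv ?p) 0 = 0" "poly (pderiv ?p) 1 = 0"
    using hump_zero[of i M] hump_zero[of "Suc i" M] assms by simp_all
  have "((\<lambda>t. if t \<in> {0..1} then poly ?p t else 0) has_vector_derivative
      (if t \<in> {0..1} then poly (pderiv ?p) t else 0)) (at t within UNIV)"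
  proof (rule has_vector_derivative_If_within_closures[where T="{..0} \<union> {1..}"])
    show "(poly ?p has_vector_derivative poly (pderiv ?p) t)
        (at t within {0..1} \<union> closure {0..1} \<inter> closure ({..0} \<union> {1..}))"
      using poly_DERIV[of ?p t] has_field_derivative_at_within
        has_real_derivative_iff_has_vector_derivative by blast
  qed (use z in auto)
  then show ?thesis by (simp only: hump_def[abs_def] has_real_derivative_iff_has_vector_derivative funpow.simps o_def)
qed


lemma hump_bounded: "\<exists>B. \<forall>t. \<bar>hump M i t\<bar> \<le> B"
proof -
  let ?p = "(pderiv ^^ i) ([:0, 1, -1:] ^ Suc M) :: real poly"
  have "compact (poly ?p ` {0..1})"
    by (intro compact_continuous_image continuous_intros) auto
  then obtain B where "\<And>t. t \<in> {0..1} \<Longrightarrow> \<bar>poly ?p t\<bar> \<le> B"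
    using compact_imp_bounded[THEN bounded_iff[THEN iffD1]] by force
  then have "\<bar>hump M i t\<bar> \<le> max B 0" for t
    by (auto simp: hump_def le_max_iff_disj simp del: power_Suc)
  then show ?thesis by blast
qed

text \<open>The profile is \<open>hump M 0\<close>. On the core, \<open>t (1 - t) \<ge> 3/16\<close>; the two regimes of the difference bound come
from the derivatives and from the supremum norm.\<close>

lemma cutoff_exists: "\<exists>\<psi> K c. cutoff M \<psi> K c"
proof -
  obtain B where B: "\<And>i t. \<bar>hump M i t\<bar> \<le> B i" using hump_bounded[of M] by metis
  define K where "K = (\<Sum>i\<le>M. B i)"
  have B0: "B i \<ge> 0" for i using B[of i 0] by linarith
  have K: "\<bar>hump M i t\<bar> \<le> K" if "i \<le> M" for i t
    using that B[of i t] B0 member_le_sum[of i "{..M}" B] by (force simp: K_def)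
  have K0: "K \<ge> 0" unfolding K_def by (intro sum_nonneg B0)
  have "cutoff M (hump M 0) (2 ^ M * K) ((3/16) ^ Suc M)"
  proof
    show "(3/16) ^ Suc M > (0::real)" by simp
    show "hump M 0 \<in> borel_measurable borel"
    proof -
      have "(\<lambda>t::real. if t \<in> {0..1} then poly ([:0, 1, -1:] ^ Suc M) t else 0) \<in> borel_measurable borel"
        by (intro measurable_If_set borel_measurable_continuous_onI continuous_intros) auto
      then show ?thesis by (simp add: hump_def[abs_def] cong: if_cong del: power_Suc)
    qed
    show "hump M 0 t = 0" if "t \<notin> {0..1}" for t using that unfolding hump_def by presburger
    show "hump M 0 t \<ge> (3/16) ^ Suc M" if t: "t \<in> {1/4..3/4}" for t
    proof -
      have "t * (1 - t) - 3/16 = (t - 1/4) * (3/4 - t)" by (simp add: field_simps)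
      also have "\<dots> \<ge> 0" using t by simp
      finally have "3/16 \<le> t * (1 - t)" by simp
      then have "(3/16) ^ Suc M \<le> (t * (1 - t)) ^ Suc M" by (rule power_mono) simp
      also have "\<dots> = hump M 0 t" using t by (simp add: hump_def poly_power algebra_simps)
      finally show ?thesis .
    qed
    fix m e t assume m: "m \<le> M"
    have 1: "\<bar>diff_op m e (hump M 0) t\<bar> \<le> K * \<bar>e\<bar> ^ m"
      using m by (intro diff_op_le_deriv[where M=M] hump_deriv K) auto
    have "K * \<bar>e\<bar> ^ m \<le> 2 ^ M * K * \<bar>e\<bar> ^ m" using K0
      by (intro mult_right_mono) (auto simp: mult_le_cancel_right1)
    moreover have "\<bar>diff_op m e (hump M 0) t\<bar> \<le> 2 ^ m * K"
      by (intro diff_op_le_sup K) auto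
    moreover have "2 ^ m * K \<le> 2 ^ M * K" using K0 m by (intro mult_right_mono power_increasing) auto
    ultimately show "\<bar>diff_op m e (hump M 0) t\<bar> \<le> 2 ^ M * K * min 1 \<bar>e\<bar> ^ m"
      using 1 by (cases "\<bar>e\<bar> \<le> 1") (auto simp: min_def)
  qed
  then show ?thesis by blast
qed

section \<open>Two-sided decay along doubling sequences\<close>

text \<open>An atom of frequency \<open>\<lambda>\<close> reacts to a step \<open>h\<close> according to \<open>t = \<lambda> |h|\<close>: differences of a smooth
function gain a power of \<open>t\<close> when \<open>t\<close> is small, and the smallness of an atom of high frequency
gives a power of \<open>1 / t\<close> when \<open>t\<close> is large.\<close>

definition decay :: "real \<Rightarrow> real \<Rightarrow> real" where
  "decay \<sigma> t = min t (1 / t) powr \<sigma>"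

lemma decay_nonneg: "decay \<sigma> t \<ge> 0" by (simp add: decay_def)

lemma decay_inverse: "decay \<sigma> (1 / t) = decay \<sigma> t" by (simp add: decay_def min.commute)

lemma decay_powr: "t > 0 \<Longrightarrow> decay \<sigma> t powr b = decay (\<sigma> * b) t"
  by (simp add: decay_def powr_powr)

text \<open>The increasing function \<open>B u = u - 1\<close> for \<open>u \<le> 1\<close> and \<open>B u = 1 - 1 / u\<close> for \<open>u > 1\<close> takes values
in \<open>[-1, 1]\<close>, and passing from \<open>u\<close> to a point beyond \<open>L u\<close> increases it by at least
\<open>(1 - 1 / L) min(u, 1 / u)\<close>. The sum telescopes, with a bound independent of where the sequence
passes through \<open>1\<close>.\<close>

lemma sum_doubling_le:
  fixes x :: "nat \<Rightarrow> real"
  assumes L: "L > 1" and pos: "\<And>k. x k > 0" and grow: "\<And>k. x (Suc k) \<ge> L * x k"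
  shows "(\<Sum>k<n. min (x k) (1 / x k)) \<le> 2 * L / (L - 1)"
proof -
  define B where "B u = (if u \<le> 1 then u - 1 else 1 - 1 / u)" for u :: real
  have step: "(1 - 1 / L) * min u (1 / u) \<le> B v - B u" if u: "u > 0" and v: "v \<ge> L * u" for u v
  proof -
    have v0: "v > 0" using u v L by (smt (verit) mult_pos_pos)
    have uv: "u / v \<le> 1 / L" using v v0 L by (simp add: divide_simps mult.commute)
    consider "u > 1" | "u \<le> 1" "v \<le> 1" | "u \<le> 1" "v > 1" by linarith
    then show ?thesis
    proof cases
      case 1
      then have v1: "v > 1" using v L by (smt (verit) mult_less_cancel_right1 mult_left_mono)
      have "1 / u \<le> u" using 1 by (simp add: divide_le_eq) (smt (verit) mult_less_cancel_right1)
      moreover have "1 / v \<le> 1 / u / L" using uv u v0 L by (simp add: field_simps)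
      ultimately show ?thesis using 1 v1 by (simp add: B_def algebra_simps)
    next
      case 2
      then have "min u (1 / u) = u" using u by (simp add: min_def le_divide_eq mult_le_one)
      moreover have "u - u / L \<le> v - u"
      proof -
        have "0 \<le> u * (L - 1)^2 / L" using u L by simp
        also have "u * (L - 1)^2 / L = L * u - u - (u - u / L)" using L by (simp add: field_simps power2_eq_square)
        finally show ?thesis using v by linarith
      qed
      ultimately show ?thesis using 2 by (simp add: B_def algebra_simps)
    next
      case 3
      then have "min u (1 / u) = u" using u by (simp add: min_def le_divide_eq mult_le_one)
      moreover have "u - u / L \<le> (1 - 1 / v) - (u - 1)"
      proof (cases "L * u \<le> 1")
        case True
        have "1 - 1/v \<ge> 0" using 3 by simp
        moreover have "u * (2 - 1 / L) \<le> 1 / L * (2 - 1 / L)"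
          using True L by (intro mult_right_mono) (auto simp: field_simps)
        moreover have "1 / L * (2 - 1 / L) \<le> 1"
          using zero_le_power2[of "1 - 1 / L"] by (simp add: power2_eq_square algebra_simps)
        ultimately show ?thesis by (simp add: algebra_simps)
      next
        case False
        have "1 / v \<le> 1 / (L * u)" using v v0 u L by (simp add: field_simps)
        \<comment> \<open>Multiplied by \<open>u\<close>, this is a quadratic inequality; \<open>u = 1\<close> is one of its roots.\<close>
        moreover have "u * (2 - 1 / L) + 1 / (L * u) \<le> 2"
        proof -
          have "0 \<le> (1 - u) * ((2 - 1/L) * u - 1 / L)"
          proof (intro mult_nonneg_nonneg)
            have "(2 - 1/L) * (1 / L) \<le> (2 - 1/L) * u"
              using False L by (intro mult_left_mono) (auto simp: field_simps)
            moreover have "1 / L \<le> (2 - 1/L) * (1 / L)" using L by (simp add: field_simps)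
            ultimately show "0 \<le> (2 - 1/L) * u - 1 / L" by linarith
          qed (use 3 in auto)
          then have "0 \<le> ((1 - u) * ((2 - 1/L) * u - 1 / L)) / u" using u by simp
          also have "\<dots> = 2 - u * (2 - 1 / L) - 1 / (L * u)"
            using u L by (simp add: field_simps)
          finally show ?thesis by simp
        qed
        ultimately show ?thesis by (simp add: algebra_simps)
      qed
      ultimately show ?thesis using 3 by (simp add: B_def algebra_simps)
    qed
  qed
  have Bb: "-1 \<le> B u" "B u \<le> 1" if "u > 0" for u using that by (auto simp: B_def intro: order_trans[of _ 1])
  have "(1 - 1 / L) * (\<Sum>k<n. min (x k) (1 / x k)) = (\<Sum>k<n. (1 - 1 / L) * min (x k) (1 / x k))"
    by (rule sum_distrib_left)
  also have "\<dots> \<le> (\<Sum>k<n. B (x (Suc k)) - B (x k))" by (intro sum_mono step pos grow)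
  also have "\<dots> = B (x n) - B (x 0)" by (rule sum_lessThan_telescope)
  also have "\<dots> \<le> 2" using Bb[OF pos, of n] Bb[OF pos, of 0] by linarith
  finally show ?thesis using L by (simp add: field_simps)
qed

definition decay_bound :: "real \<Rightarrow> real" where
  "decay_bound \<sigma> = 2 * 2 powr \<sigma> / (2 powr \<sigma> - 1)"

lemma decay_bound_pos: "\<sigma> > 0 \<Longrightarrow> decay_bound \<sigma> > 0"
  by (simp add: decay_bound_def)

lemma suminf_decay_le:
  fixes t :: "nat \<Rightarrow> real"
  assumes "\<sigma> > 0" and pos: "\<And>k. t k > 0" and grow: "\<And>k. t (Suc k) \<ge> 2 * t k"
  shows "(\<Sum>k. ennreal (decay \<sigma> (t k))) \<le> ennreal (decay_bound \<sigma>)"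
  unfolding decay_bound_def
proof (rule suminf_le_const[OF summableI])
  fix n
  have eq: "decay \<sigma> (t k) = min (t k powr \<sigma>) (1 / t k powr \<sigma>)" for k
  proof -
    have "decay \<sigma> (t k) = min (t k powr \<sigma>) ((1 / t k) powr \<sigma>)"
      using powr_mono2[of \<sigma> "1 / t k" "t k"] powr_mono2[of \<sigma> "t k" "1 / t k"] pos[of k] \<open>\<sigma> > 0\<close>
      unfolding decay_def by (cases "t k \<le> 1 / t k") (auto simp: min_def)
    then show ?thesis using pos[of k] by (simp add: powr_divide)
  qed
  have "(\<Sum>k<n. decay \<sigma> (t k)) \<le> 2 * 2 powr \<sigma> / (2 powr \<sigma> - 1)"
    unfolding eq
  proof (rule sum_doubling_le)
    show "2 powr \<sigma> > 1" using \<open>\<sigma> > 0\<close> by simp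
    show "t k powr \<sigma> > 0" for k using pos[of k] by simp
    show "2 powr \<sigma> * t k powr \<sigma> \<le> t (Suc k) powr \<sigma>" for k
      using pos[of k] grow[of k] \<open>\<sigma> > 0\<close> by (subst powr_mult[symmetric]) (auto intro: powr_mono2)
  qed
  then show "(\<Sum>k<n. ennreal (decay \<sigma> (t k))) \<le> ennreal (2 * 2 powr \<sigma> / (2 powr \<sigma> - 1))"
    by (simp add: sum_ennreal decay_nonneg ennreal_leI)
qed

text \<open>This allows the length of a step to be replaced by the power of two above it.\<close>

lemma decay_le_decay:
  assumes "\<sigma> > 0" "0 < t" "t \<le> u" "u \<le> 2 * t"
  shows "decay \<sigma> t \<le> 2 powr \<sigma> * decay \<sigma> u"
proof -
  have "min t (1 / t) \<le> 2 * min u (1 / u)"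
  proof -
    have "1 / t \<le> 2 * (1 / u)" using assms by (simp add: field_simps)
    then show ?thesis using assms by (auto simp: min_def)
  qed
  then have "decay \<sigma> t \<le> (2 * min u (1 / u)) powr \<sigma>"
    unfolding decay_def using assms by (intro powr_mono2) auto
  then show ?thesis using assms by (simp add: decay_def powr_mult)
qed

text \<open>The left side is the estimate of an atom with the factor \<open>|h|\<^sup>s\<^sup>P\<close> taken out. The hypotheses
\<open>0 < s < M\<close> say that both of its exponents, \<open>(M - s) P\<close> at zero and \<open>- s P\<close> at infinity, have the
right sign.\<close>

lemma decay_dominates:
  assumes "t > 0" "0 < s" "s < M" "P > 0"
  shows "t powr (- (s * P)) * min 1 t powr (M * P) \<le> decay (min s (M - s) * P) t"
proof (cases "t \<le> 1")
  case True
  then have "min t (1 / t) = t" using assms by (simp add: min_def le_divide_eq mult_le_one)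
  moreover have "t powr ((M - s) * P) \<le> t powr (min s (M - s) * P)"
    using assms True by (intro powr_mono') auto
  ultimately show ?thesis using True assms by (simp add: decay_def powr_add[symmetric] algebra_simps)
next
  case False
  then have "1 / t \<le> t" using assms by (simp add: divide_le_eq) (smt (verit) mult_less_cancel_right1)
  then have "decay (min s (M - s) * P) t = t powr - (min s (M - s) * P)"
    using assms by (simp add: decay_def powr_divide powr_minus_divide)
  moreover have "t powr - (s * P) \<le> t powr - (min s (M - s) * P)"
    using assms False by (intro powr_mono) auto
  ultimately show ?thesis using False by simp
qed

section \<open>Bumps adapted to a box\<close>

definition box_bump :: "(real \<Rightarrow> real) \<Rightarrow> ('e::euclidean_space \<Rightarrow> real) \<Rightarrow> 'e \<Rightarrow> 'e \<Rightarrow> real" where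
  "box_bump \<psi> \<mu> z0 z = (\<Prod>b\<in>Basis. \<psi> (\<mu> b * ((z - z0) \<bullet> b)))"

lemma emeasure_scaled_box:
  fixes w :: "'e::euclidean_space"
  assumes \<mu>: "\<And>b. b \<in> Basis \<Longrightarrow> 0 < \<mu> b" and ab: "\<alpha> \<le> \<beta>"
  shows "{z. \<forall>b\<in>Basis. \<mu> b * ((z - w) \<bullet> b) \<in> {\<alpha>..\<beta>}} \<in> sets lborel"
    and "emeasure lborel {z. \<forall>b\<in>Basis. \<mu> b * ((z - w) \<bullet> b) \<in> {\<alpha>..\<beta>}} = ennreal (\<Prod>b\<in>Basis. (\<beta> - \<alpha>) / \<mu> b)"
proof -
  define u v where "u = (\<Sum>b\<in>Basis. (w \<bullet> b + \<alpha> / \<mu> b) *\<^sub>R b)" and "v = (\<Sum>b\<in>Basis. (w \<bullet> b + \<beta> / \<mu> b) *\<^sub>R b)"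
  have uv: "u \<bullet> b = w \<bullet> b + \<alpha> / \<mu> b" "v \<bullet> b = w \<bullet> b + \<beta> / \<mu> b" if "b \<in> Basis" for b
    using that by (simp_all add: u_def v_def)
  have eq: "{z. \<forall>b\<in>Basis. \<mu> b * ((z - w) \<bullet> b) \<in> {\<alpha>..\<beta>}} = cbox u v"
    unfolding cbox_def
  proof (intro Collect_cong ball_cong[OF refl])
    fix z b :: 'e assume b: "b \<in> Basis"
    show "\<mu> b * ((z - w) \<bullet> b) \<in> {\<alpha>..\<beta>} \<longleftrightarrow> u \<bullet> b \<le> z \<bullet> b \<and> z \<bullet> b \<le> v \<bullet> b"
      using \<mu>[OF b] unfolding uv[OF b] inner_diff_left
      by (auto simp: field_simps)
  qed
  show "{z. \<forall>b\<in>Basis. \<mu> b * ((z - w) \<bullet> b) \<in> {\<alpha>..\<beta>}} \<in> sets lborel" unfolding eq by simp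
  have "emeasure lborel (cbox u v) = (\<Prod>b\<in>Basis. (v - u) \<bullet> b)"
  proof (rule emeasure_lborel_cbox)
    fix b :: 'e assume "b \<in> Basis"
    then show "u \<bullet> b \<le> v \<bullet> b" using \<mu>[of b] ab by (simp add: uv divide_right_mono)
  qed
  also have "(\<Prod>b\<in>Basis. (v - u) \<bullet> b) = (\<Prod>b\<in>Basis. (\<beta> - \<alpha>) / \<mu> b)"
    by (intro prod.cong refl) (simp add: uv inner_diff_left diff_divide_distrib)
  finally show "emeasure lborel {z. \<forall>b\<in>Basis. \<mu> b * ((z - w) \<bullet> b) \<in> {\<alpha>..\<beta>}} = ennreal (\<Prod>b\<in>Basis. (\<beta> - \<alpha>) / \<mu> b)"
    unfolding eq by simp
qed

context cutoff
begin

lemma K_nonneg: "K \<ge> 0"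
  using cutoff_diff[of 0 0 0] by simp

lemma box_bump_borel: "box_bump \<psi> \<mu> z0 \<in> borel_measurable borel"
  unfolding box_bump_def[abs_def]
  by (intro borel_measurable_prod measurable_compose[OF _ cutoff_borel]) simp

lemma box_bump_support:
  assumes "box_bump \<psi> \<mu> z0 z \<noteq> 0" "b \<in> Basis"
  shows "\<mu> b * ((z - z0) \<bullet> b) \<in> {0..1}"
  using assms cutoff_support unfolding box_bump_def by (metis finite_Basis prod_zero)

text \<open>The bump is a product of functions of one coordinate, and along \<open>b\<close> a step \<open>h\<close> acts on the
profile as a step of size \<open>\<mu> b * (h \<bullet> b)\<close>, at most \<open>L |h|\<close>. Only the largest scale enters the estimate: a
bump that is wide in some directions is not worse than a narrow one.\<close>

lemma box_bump_diff_le: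
  fixes h :: "'e::euclidean_space"
  assumes "m \<le> M" and \<mu>: "\<And>b. b \<in> Basis \<Longrightarrow> 0 < \<mu> b \<and> \<mu> b \<le> L"
  shows "\<bar>diff_op m h (box_bump \<psi> \<mu> z0) z\<bar> \<le> (2 ^ M * K) ^ DIM('e) * min 1 (L * norm h) ^ m"
proof -
  have "L \<ge> 0" using \<mu>[OF SOME_Basis] by linarith
  have b: "\<bar>diff_op i h (\<lambda>z. \<psi> (\<mu> b * ((z - z0) \<bullet> b))) z\<bar> \<le> K * min 1 (L * norm h) ^ i"
    if b: "b \<in> Basis" and i: "i \<le> M" for b i z
  proof -
    have "diff_op i h (\<lambda>z. \<psi> (\<mu> b * ((z - z0) \<bullet> b))) z = diff_op i (\<mu> b * (h \<bullet> b)) \<psi> (\<mu> b * ((z - z0) \<bullet> b))"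
      by (rule diff_op_affine) (simp add: algebra_simps inner_simps)
    also have "\<bar>\<dots>\<bar> \<le> K * min 1 \<bar>\<mu> b * (h \<bullet> b)\<bar> ^ i" by (rule cutoff_diff[OF i])
    also have "\<dots> \<le> K * min 1 (L * norm h) ^ i"
    proof -
      have "\<bar>\<mu> b * (h \<bullet> b)\<bar> \<le> L * norm h"
        using \<mu>[OF b] Basis_le_norm[OF b, of h] by (auto simp: abs_mult intro!: mult_mono)
      then show ?thesis by (intro mult_left_mono power_mono K_nonneg) auto
    qed
    finally show ?thesis .
  qed
  show ?thesis unfolding box_bump_def[abs_def]
    by (rule diff_op_prod_le) (use b \<open>m \<le> M\<close> \<open>L \<ge> 0\<close> in auto)
qed

text \<open>The difference is bounded pointwise and lives on the \<open>m + 1\<close> translates of the box that supports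
the bump, whatever the size of \<open>h\<close>.\<close>

lemma box_bump_diff_integral:
  fixes h :: "'e::euclidean_space"
  assumes "m \<le> M" and \<mu>: "\<And>b. b \<in> Basis \<Longrightarrow> 0 < \<mu> b \<and> \<mu> b \<le> L" and "P > 0"
  shows "(\<integral>\<^sup>+z. ennreal (\<bar>diff_op m h (box_bump \<psi> \<mu> z0) z\<bar> powr P) \<partial>lborel)
    \<le> ennreal (((2 ^ M * K) ^ DIM('e) * min 1 (L * norm h) ^ m) powr P * (real (Suc M) * (\<Prod>b\<in>Basis. 1 / \<mu> b)))"
proof -
  define A where "A = (2 ^ M * K) ^ DIM('e) * min 1 (L * norm h) ^ m"
  define V where "V = (\<Prod>b\<in>Basis. 1 / \<mu> b)"
  have V0: "V \<ge> 0" unfolding V_def using \<mu> by (intro prod_nonneg) (auto intro: less_imp_le)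
  define S where "S j = {z. \<forall>b\<in>Basis. \<mu> b * ((z - (z0 - real j *\<^sub>R h)) \<bullet> b) \<in> {0..1}}" for j
  have S: "S j \<in> sets lborel" "emeasure lborel (S j) = ennreal V" for j
    using emeasure_scaled_box[of \<mu> 0 1 "z0 - real j *\<^sub>R h"] \<mu> unfolding S_def V_def by auto
  have "ennreal (\<bar>diff_op m h (box_bump \<psi> \<mu> z0) z\<bar> powr P) \<le> ennreal (A powr P) * indicator (\<Union>j\<in>{0..m}. S j) z" for z
  proof (cases "z \<in> (\<Union>j\<in>{0..m}. S j)")
    case True
    then show ?thesis
      using box_bump_diff_le[OF \<open>m \<le> M\<close> \<mu>, where h=h and z=z and ?z0.0=z0] \<open>P > 0\<close>
      unfolding A_def by (auto intro!: ennreal_leI powr_mono2)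
  next
    case False
    have "box_bump \<psi> \<mu> z0 (z + real j *\<^sub>R h) = 0" if "j \<in> {0..m}" for j
    proof (rule ccontr)
      assume "box_bump \<psi> \<mu> z0 (z + real j *\<^sub>R h) \<noteq> 0"
      from box_bump_support[OF this] have "z \<in> S j"
        unfolding S_def by (simp add: diff_diff_eq2 add_diff_eq algebra_simps)
      then show False using False that by auto
    qed
    then have "diff_op m h (box_bump \<psi> \<mu> z0) z = 0" unfolding diff_op_def by (intro sum.neutral) auto
    then show ?thesis by simp
  qed
  then have "(\<integral>\<^sup>+z. ennreal (\<bar>diff_op m h (box_bump \<psi> \<mu> z0) z\<bar> powr P) \<partial>lborel)
      \<le> (\<integral>\<^sup>+z. ennreal (A powr P) * indicator (\<Union>j\<in>{0..m}. S j) z \<partial>lborel)"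
    by (intro nn_integral_mono)
  also have "\<dots> = ennreal (A powr P) * emeasure lborel (\<Union>j\<in>{0..m}. S j)"
    using S by (intro nn_integral_cmult_indicator) auto
  also have "emeasure lborel (\<Union>j\<in>{0..m}. S j) \<le> (\<Sum>j\<in>{0..m}. emeasure lborel (S j))"
    using S by (intro emeasure_subadditive_finite) auto
  also have "\<dots> = ennreal (real (Suc m) * V)"
    using V0 by (simp add: S ennreal_mult ennreal_of_nat_eq_real_of_nat)
  also have "\<dots> \<le> ennreal (real (Suc M) * V)"
    using V0 \<open>m \<le> M\<close> by (intro ennreal_leI mult_right_mono) auto
  finally show ?thesis using V0 by (simp add: A_def[symmetric] V_def[symmetric] ennreal_mult mult_left_mono)
qed

end

section \<open>Atoms at lacunary frequencies\<close>

lemma term_le_suminf: "f i \<le> (\<Sum>k. f k)" for f :: "nat \<Rightarrow> ennreal"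
  using sum_le_suminf[OF summableI, of "{i}" f] by simp

lemma prod_Basis_Pair:
  fixes g :: "'a::euclidean_space \<times> 'b::euclidean_space \<Rightarrow> real"
  shows "(\<Prod>b\<in>Basis. g b) = (\<Prod>e\<in>Basis. g (e, 0)) * (\<Prod>e\<in>Basis. g (0, e))"
proof -
  have "(\<Prod>b\<in>(Basis :: ('a \<times> 'b) set). g b) =
      (\<Prod>b\<in>(\<lambda>e. (e, 0)) ` Basis. g b) * (\<Prod>b\<in>(\<lambda>e. (0, e)) ` Basis. g b)"
    unfolding Basis_prod_def by (rule prod.union_disjoint) auto
  then show ?thesis by (simp add: prod.reindex inj_on_def)
qed

lemma diff_op_borel:
  fixes G :: "'e::euclidean_space \<Rightarrow> real"
  assumes "G \<in> borel_measurable borel"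
  shows "diff_op m h G \<in> borel_measurable borel"
  unfolding diff_op_def[abs_def]
  by (intro borel_measurable_sum borel_measurable_times measurable_compose[OF _ assms]) auto

lemma powr_abs_borel:
  fixes G :: "'e::euclidean_space \<Rightarrow> real"
  assumes [measurable]: "G \<in> borel_measurable borel"
  shows "(\<lambda>z. ennreal (\<bar>G z\<bar> powr P)) \<in> borel_measurable lborel"
  by measurable

text \<open>The parameters of the atoms: height \<open>a k\<close>, and corner \<open>\<eta> k\<close> and side length \<open>r k\<close> of the cube in the
variable \<open>y\<close>. Along the direction \<open>e0\<close> the atoms are separated in the variable \<open>x\<close>.\<close>

locale lacunary_atoms = cutoff M \<psi> K c
  for M :: nat and \<psi> :: "real \<Rightarrow> real" and K c :: real +
  fixes s P :: real and a r :: "nat \<Rightarrow> real"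
    and \<eta> :: "nat \<Rightarrow> 'b::euclidean_space" and e0 :: "'a::euclidean_space"
  assumes s: "0 < s" "s < real M" and P: "P > 0"
    and a: "\<And>k. a k > 0" and r: "\<And>k. 0 < r k" "\<And>k. r k \<le> 1"
    and e0: "e0 \<in> Basis"
begin

text \<open>A product formula that meets two demands at once: doubling from each index to the next, and
\<open>freq k \<ge> 1 / r k\<close>, so that the atom does not vary faster in \<open>y\<close> than in \<open>x\<close>.\<close>

definition freq :: "nat \<Rightarrow> real" where "freq k = (\<Prod>j\<le>k. 2 / r j)"

lemma freq_ge_1: "freq k \<ge> 1"
  unfolding freq_def using r
  by (intro prod_ge_1) (smt (verit) divide_le_eq_1 le_divide_eq_1)

lemma freq_pos: "freq k > 0"
  using freq_ge_1[of k] by linarith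

lemma freq_Suc: "freq (Suc k) \<ge> 2 * freq k"
proof -
  have "2 / r (Suc k) \<ge> 2" using r[of "Suc k"] by (simp add: le_divide_eq)
  then have "freq k * 2 \<le> freq k * (2 / r (Suc k))"
    using freq_pos[of k] by (intro mult_left_mono) auto
  then show ?thesis by (simp add: freq_def mult_ac)
qed

lemma freq_ge_inverse: "freq k \<ge> 1 / r k"
proof (cases k)
  case 0
  then show ?thesis using r[of 0] by (simp add: freq_def divide_right_mono)
next
  case (Suc l)
  have "1 / r k \<le> 1 * (2 / r k)" using r(1)[of k] by (simp add: divide_right_mono)
  also have "\<dots> \<le> freq l * (2 / r k)" using freq_ge_1[of l] r(1)[of k] by (intro mult_right_mono) auto
  finally show ?thesis by (simp add: freq_def Suc)
qed

definition scale :: "nat \<Rightarrow> 'a \<times> 'b \<Rightarrow> real" where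
  "scale k b = (if snd b = 0 then freq k else 1 / r k)"

text \<open>Consecutive corners are \<open>2 M + 2\<close> apart. With the shift by \<open>M\<close>, every \<open>x\<close> from which
some \<open>x + j h\<close> with \<open>j \<le> M\<close> and \<open>|h| \<le> 1\<close> reaches the support of the \<open>k\<close>-th atom satisfies \<open>block x = k\<close>.\<close>

definition corner :: "nat \<Rightarrow> 'a \<times> 'b" where
  "corner k = ((real M + real k * (2 * real M + 2)) *\<^sub>R e0, \<eta> k)"

text \<open>The power of the frequency compensates the volume \<open>freq k ^ (- d)\<close> of the support in \<open>x\<close> and
leaves a slice whose \<open>L\<^sup>P\<close> norm is of the order \<open>a k * freq k powr (- s)\<close>.\<close>

definition amp :: "nat \<Rightarrow> real" where
  "amp k = a k * freq k powr (real DIM('a) / P - s)"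

definition atom :: "nat \<Rightarrow> 'a \<times> 'b \<Rightarrow> real" where
  "atom k z = amp k * box_bump \<psi> (scale k) (corner k) z"

definition weight :: "nat \<Rightarrow> real" where
  "weight k = a k powr P * r k ^ DIM('b)"

lemma weight_nonneg: "weight k \<ge> 0" using r[of k] by (simp add: weight_def)

lemma amp_pos: "amp k > 0" using a[of k] freq_pos[of k] by (simp add: amp_def)

lemma scale_pos: "0 < scale k b" and scale_le: "scale k b \<le> freq k"
  using freq_pos[of k] freq_ge_inverse[of k] r[of k] by (auto simp: scale_def)

lemma atom_borel: "atom k \<in> borel_measurable borel"
  unfolding atom_def[abs_def] by (intro borel_measurable_times box_bump_borel) auto

definition atom_const :: real where
  "atom_const = ((2 ^ M * K) ^ DIM('a \<times> 'b)) powr P * real (Suc M)"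

lemma atom_const_nonneg: "atom_const \<ge> 0" by (simp add: atom_const_def)

text \<open>The volume of the support turns \<open>amp k powr P\<close> into \<open>weight k * freq k powr (- (s * P))\<close>. The order \<open>m = 0\<close>
is included in order to estimate the norm of the function itself.\<close>

lemma atom_diff_integral:
  assumes "m \<le> M"
  shows "(\<integral>\<^sup>+z. ennreal (\<bar>diff_op m h (atom k) z\<bar> powr P) \<partial>lborel)
    \<le> ennreal (atom_const * weight k * freq k powr (- (s * P)) * (min 1 (freq k * norm h) ^ m) powr P)"
proof -
  have vol: "(\<Prod>b\<in>(Basis::('a \<times> 'b) set). 1 / scale k b) = (1 / freq k) ^ DIM('a) * r k ^ DIM('b)"
  proof -
    have "(\<Prod>e\<in>(Basis::'b set). 1 / scale k (0, e)) = (\<Prod>e\<in>(Basis::'b set). r k)"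
      by (intro prod.cong refl) (auto simp: scale_def)
    moreover have "(\<Prod>e\<in>(Basis::'a set). 1 / scale k (e, 0)) = (1 / freq k) ^ DIM('a)"
      by (simp add: scale_def)
    ultimately show ?thesis unfolding prod_Basis_Pair by simp
  qed
  have "(\<integral>\<^sup>+z. ennreal (\<bar>diff_op m h (atom k) z\<bar> powr P) \<partial>lborel) =
      (\<integral>\<^sup>+z. ennreal (amp k powr P) * ennreal (\<bar>diff_op m h (box_bump \<psi> (scale k) (corner k)) z\<bar> powr P) \<partial>lborel)"
    unfolding atom_def[abs_def] diff_op_cmult using amp_pos[of k]
    by (simp add: abs_mult powr_mult ennreal_mult)
  also have "\<dots> = ennreal (amp k powr P) *
      (\<integral>\<^sup>+z. ennreal (\<bar>diff_op m h (box_bump \<psi> (scale k) (corner k)) z\<bar> powr P) \<partial>lborel)"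
    by (intro nn_integral_cmult powr_abs_borel diff_op_borel box_bump_borel)
  also have "\<dots> \<le> ennreal (amp k powr P) *
      ennreal (((2 ^ M * K) ^ DIM('a \<times> 'b) * min 1 (freq k * norm h) ^ m) powr P *
        (real (Suc M) * (\<Prod>b\<in>(Basis::('a \<times> 'b) set). 1 / scale k b)))"
    by (intro mult_left_mono box_bump_diff_integral assms P) (auto simp: scale_pos scale_le)
  also have "\<dots> = ennreal (amp k powr P * (((2 ^ M * K) ^ DIM('a \<times> 'b) * min 1 (freq k * norm h) ^ m) powr P *
        (real (Suc M) * (\<Prod>b\<in>(Basis::('a \<times> 'b) set). 1 / scale k b))))"
    by (rule ennreal_mult'[symmetric]) simp
  also have "\<dots> = ennreal (atom_const * weight k * freq k powr (- (s * P)) * (min 1 (freq k * norm h) ^ m) powr P)"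
  proof -
    have "amp k powr P = a k powr P * freq k powr (real DIM('a) - s * P)"
      using a[of k] freq_pos[of k] P by (simp add: amp_def powr_mult powr_powr left_diff_distrib)
    also have "\<dots> = a k powr P * freq k ^ DIM('a) * freq k powr (- (s * P))"
      using freq_pos[of k] by (simp add: powr_diff powr_realpow powr_minus divide_inverse)
    finally have "amp k powr P * (1 / freq k) ^ DIM('a) = a k powr P * freq k powr (- (s * P))"
      using freq_pos[of k] by (simp add: power_divide)
    then have "amp k powr P * (\<Prod>b\<in>(Basis::('a \<times> 'b) set). 1 / scale k b) = weight k * freq k powr (- (s * P))"
      unfolding vol weight_def by simp
    moreover have "((2 ^ M * K) ^ DIM('a \<times> 'b) * min 1 (freq k * norm h) ^ m) powr P =
        ((2 ^ M * K) ^ DIM('a \<times> 'b)) powr P * (min 1 (freq k * norm h) ^ m) powr P"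
      by (rule powr_mult)
    moreover have "A * (Q * (R * V)) = B * R * w * f * mm" if "A * V = w * f" "Q = B * mm" for A Q R V B w f mm :: real
    proof -
      have "A * (Q * (R * V)) = B * R * (A * V) * mm" unfolding that(2) by (simp only: mult_ac)
      then show ?thesis unfolding that(1) by (simp only: mult_ac)
    qed
    ultimately show ?thesis unfolding atom_const_def by (intro arg_cong[of _ _ ennreal])
  qed
  finally show ?thesis .
qed

text \<open>The index of the only atom that can matter near \<open>x\<close>. For \<open>x\<close> with negative \<open>e0\<close>-coordinate
the value is \<open>0\<close>, as it should be: only the atom of index \<open>0\<close> can be reached from there.\<close>

definition block :: "'a \<Rightarrow> nat" where
  "block x = nat \<lfloor>(x \<bullet> e0) / (2 * real M + 2)\<rfloor>"

text \<open>The sum of all atoms, written without an infinite sum: at each point every atom but one vanishes.\<close>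

definition example :: "'a \<times> 'b \<Rightarrow> real" where
  "example z = atom (block (fst z)) z"

lemma block_eqI:
  assumes "atom k (x + v, y) \<noteq> 0" and v: "\<bar>v \<bullet> e0\<bar> \<le> real M"
  shows "block x = k"
proof -
  have "(e0, 0) \<in> (Basis :: ('a \<times> 'b) set)" using e0 by (simp add: Basis_prod_def)
  with assms(1) have "scale k (e0, 0) * (((x + v, y) - corner k) \<bullet> (e0, 0)) \<in> {0..1}"
    by (intro box_bump_support) (auto simp: atom_def)
  then have 1: "freq k * (x \<bullet> e0 + v \<bullet> e0 - (real M + real k * (2 * real M + 2))) \<in> {0..1}" (is "freq k * ?t \<in> _")
    using e0 by (simp add: scale_def corner_def inner_diff_left inner_add_left)
  have "?t \<ge> 0" using 1 freq_pos[of k] by (simp add: zero_le_mult_iff)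
  moreover from this have "?t \<le> 1" using 1 freq_ge_1[of k] mult_right_mono[of 1 "freq k" ?t] by auto
  ultimately have "real k * (2 * real M + 2) \<le> x \<bullet> e0" "x \<bullet> e0 < (real k + 1) * (2 * real M + 2)"
    using v by (auto simp: abs_le_iff algebra_simps)
  then have "\<lfloor>(x \<bullet> e0) / (2 * real M + 2)\<rfloor> = int k"
    by (intro floor_unique) (auto simp: field_simps)
  then show ?thesis by (simp add: block_def)
qed

lemma example_near:
  assumes "norm h \<le> 1" "j \<le> M"
  shows "example (z + real j *\<^sub>R h) = atom (block (fst z)) (z + real j *\<^sub>R h)"
proof -
  obtain x y u v where z: "z = (x, y)" and h: "h = (u, v)" by force
  have "\<bar>u \<bullet> e0\<bar> \<le> 1"
    using Basis_le_norm[OF e0, of u] norm_fst_le[of u v] assms(1) unfolding h by linarith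
  then have "real j * \<bar>u \<bullet> e0\<bar> \<le> real M * 1" using assms(2) by (intro mult_mono) auto
  then have ju: "\<bar>(real j *\<^sub>R u) \<bullet> e0\<bar> \<le> real M" by (simp add: abs_mult)
  show ?thesis
  proof (cases "block (x + real j *\<^sub>R u) = block x")
    case True
    then show ?thesis by (simp add: example_def z h)
  next
    case False
    have "atom (block (x + real j *\<^sub>R u)) (z + real j *\<^sub>R h) = 0"
      using block_eqI[OF _ ju, of _ x "y + real j *\<^sub>R v"] False by (force simp: z h)
    moreover have "atom (block x) (z + real j *\<^sub>R h) = 0"
      using block_eqI[of "block x" "x + real j *\<^sub>R u" 0 "y + real j *\<^sub>R v"] False by (force simp: z h)
    ultimately show ?thesis by (simp add: example_def z h)
  qed
qed

lemma diff_op_example: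
  assumes "norm h \<le> 1" "m \<le> M"
  shows "diff_op m h example z = diff_op m h (atom (block (fst z))) z"
  unfolding diff_op_def using assms by (intro sum.cong refl) (simp add: example_near)

lemma example_borel: "example \<in> borel_measurable borel"
proof -
  have "block \<in> measurable borel (count_space UNIV)" unfolding block_def[abs_def] by measurable
  then have "(\<lambda>z::'a \<times> 'b. block (fst z)) \<in> measurable borel (count_space UNIV)"
    by (rule measurable_compose[rotated]) (intro borel_measurable_continuous_onI continuous_intros)
  then show ?thesis unfolding example_def[abs_def]
    by (rule measurable_compose_countable[of "\<lambda>k z. atom k z", OF atom_borel])
qed

text \<open>Since only one atom is active at each point, the \<open>P\<close>-th power of the difference is at most the sum
of the \<open>P\<close>-th powers over the atoms; this replaces the triangle inequality for every \<open>P > 0\<close>.\<close>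

lemma example_diff_integral:
  assumes "norm h \<le> 1" "m \<le> M"
  shows "(\<integral>\<^sup>+z. ennreal (\<bar>diff_op m h example z\<bar> powr P) \<partial>lborel)
    \<le> (\<Sum>k. ennreal (atom_const * weight k * freq k powr (- (s * P)) * (min 1 (freq k * norm h) ^ m) powr P))"
proof -
  have "ennreal (\<bar>diff_op m h example z\<bar> powr P) \<le> (\<Sum>k. ennreal (\<bar>diff_op m h (atom k) z\<bar> powr P))" for z
    unfolding diff_op_example[OF assms] by (rule term_le_suminf)
  then have "(\<integral>\<^sup>+z. ennreal (\<bar>diff_op m h example z\<bar> powr P) \<partial>lborel)
      \<le> (\<integral>\<^sup>+z. (\<Sum>k. ennreal (\<bar>diff_op m h (atom k) z\<bar> powr P)) \<partial>lborel)"
    by (intro nn_integral_mono)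
  also have "\<dots> = (\<Sum>k. \<integral>\<^sup>+z. ennreal (\<bar>diff_op m h (atom k) z\<bar> powr P) \<partial>lborel)"
    by (intro nn_integral_suminf powr_abs_borel diff_op_borel atom_borel)
  also have "\<dots> \<le> (\<Sum>k. ennreal (atom_const * weight k * freq k powr (- (s * P)) * (min 1 (freq k * norm h) ^ m) powr P))"
    by (rule suminf_le[OF atom_diff_integral[OF assms(2)] summableI summableI])
  finally show ?thesis .
qed

abbreviation "rate \<equiv> min s (real M - s) * P"

lemma rate_pos: "rate > 0" using s P by simp

lemma example_diff_bound:
  assumes "0 < norm h" "norm h \<le> 1"
  shows "(\<integral>\<^sup>+z. ennreal (\<bar>diff_op M h example z\<bar> powr P) \<partial>lborel)
    \<le> ennreal (atom_const * norm h powr (s * P)) * (\<Sum>k. ennreal (weight k * decay rate (freq k * norm h)))"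
proof -
  have "atom_const * weight k * freq k powr (- (s * P)) * (min 1 (freq k * norm h) ^ M) powr P
      \<le> (atom_const * norm h powr (s * P)) * (weight k * decay rate (freq k * norm h))" for k
  proof -
    let ?t = "freq k * norm h"
    have t: "?t > 0" using freq_pos[of k] assms by simp
    have "freq k powr (- (s * P)) * (min 1 ?t ^ M) powr P
        = norm h powr (s * P) * (?t powr (- (s * P)) * min 1 ?t powr (real M * P))"
    proof -
      have "(min 1 ?t ^ M) powr P = min 1 ?t powr (real M * P)"
        using t by (simp add: powr_realpow[symmetric] powr_powr)
      then show ?thesis using assms freq_pos[of k] by (simp add: powr_mult powr_minus field_simps)
    qed
    also have "\<dots> \<le> norm h powr (s * P) * decay rate ?t"
      using decay_dominates[OF t s P] by (intro mult_left_mono) auto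
    finally have "(atom_const * weight k) * (freq k powr (- (s * P)) * (min 1 ?t ^ M) powr P)
        \<le> (atom_const * weight k) * (norm h powr (s * P) * decay rate ?t)"
      using atom_const_nonneg weight_nonneg[of k] by (intro mult_left_mono) auto
    then show ?thesis by (simp add: mult_ac)
  qed
  then have "(\<Sum>k. ennreal (atom_const * weight k * freq k powr (- (s * P)) * (min 1 (freq k * norm h) ^ M) powr P))
      \<le> (\<Sum>k. ennreal (atom_const * norm h powr (s * P)) * ennreal (weight k * decay rate (freq k * norm h)))"
    using atom_const_nonneg by (intro suminf_le summableI) (auto simp: ennreal_mult'[symmetric] intro!: ennreal_leI)
  then show ?thesis using example_diff_integral[OF assms(2), of M] by (auto intro: order_trans)
qed

lemma example_bound:
  "(\<integral>\<^sup>+z. ennreal (\<bar>example z\<bar> powr P) \<partial>lborel)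
    \<le> ennreal atom_const * (\<Sum>k. ennreal (weight k * decay rate (freq k)))"
proof -
  have "atom_const * weight k * freq k powr (- (s * P)) \<le> atom_const * (weight k * decay rate (freq k))" for k
    using decay_dominates[OF freq_pos s P, of k] freq_ge_1[of k] atom_const_nonneg weight_nonneg[of k]
    by (simp add: mult.assoc mult_left_mono)
  then have "(\<Sum>k. ennreal (atom_const * weight k * freq k powr (- (s * P))))
      \<le> (\<Sum>k. ennreal atom_const * ennreal (weight k * decay rate (freq k)))"
    using atom_const_nonneg by (intro suminf_le summableI) (auto simp: ennreal_mult'[symmetric] intro!: ennreal_leI)
  then show ?thesis
    using example_diff_integral[of 0 0] by (simp add: diff_op_0)
qed

text \<open>With the step \<open>e0 / freq k\<close> the points \<open>x + j h\<close> run through consecutive unit cells of the rescaled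
profile. If \<open>x + M h\<close> is in the core of the \<open>k\<close>-th atom, the other \<open>M\<close> points lie outside its support, and the
difference reduces to the term \<open>j = M\<close>, whose coefficient is \<open>1\<close>.\<close>

lemma slice_diff_integral:
  assumes y: "\<And>b. b \<in> Basis \<Longrightarrow> (y - \<eta> k) \<bullet> b / r k \<in> {1/4..3/4}"
  shows "ennreal ((a k * c ^ DIM('a \<times> 'b)) powr P * (1/2) ^ DIM('a) * freq k powr (- (s * P)))
    \<le> (\<integral>\<^sup>+x. ennreal (\<bar>diff_op M ((1 / freq k) *\<^sub>R e0) (\<lambda>x. example (x, y)) x\<bar> powr P) \<partial>lborel)"
proof -
  define h where "h = (1 / freq k) *\<^sub>R e0"
  define S where "S = {x. \<forall>b\<in>Basis. freq k * ((x - (fst (corner k) - real M *\<^sub>R h)) \<bullet> b) \<in> {1/4..3/4}}"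
  have S: "S \<in> sets lborel" "emeasure lborel S = ennreal ((1 / (2 * freq k)) ^ DIM('a))"
    using emeasure_scaled_box[of "\<lambda>_. freq k" "1/4" "3/4" "fst (corner k) - real M *\<^sub>R h"] freq_pos[of k]
    unfolding S_def by auto
  have "norm e0 = 1" using e0 by simp
  then have nh: "norm (h, 0::'b) \<le> 1" using freq_ge_1[of k] by (simp add: h_def norm_Pair)
  have val: "amp k * c ^ DIM('a \<times> 'b) \<le> \<bar>diff_op M h (\<lambda>x. example (x, y)) x\<bar>" if x: "x \<in> S" for x
  proof -
    have top: "amp k * c ^ DIM('a \<times> 'b) \<le> atom k (x + real M *\<^sub>R h, y)"
    proof -
      have "(\<Prod>b\<in>(Basis::('a \<times> 'b) set). c) \<le> box_bump \<psi> (scale k) (corner k) (x + real M *\<^sub>R h, y)"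
        unfolding box_bump_def
      proof (rule prod_mono, intro conjI)
        fix b :: "'a \<times> 'b" assume b: "b \<in> Basis"
        show "c \<le> \<psi> (scale k b * (((x + real M *\<^sub>R h, y) - corner k) \<bullet> b))"
        proof (rule cutoff_core)
          from b consider u where "b = (u, 0)" "u \<in> Basis" | u where "b = (0, u)" "u \<in> Basis"
            unfolding Basis_prod_def by auto
          then show "scale k b * (((x + real M *\<^sub>R h, y) - corner k) \<bullet> b) \<in> {1/4..3/4}"
          proof cases
            case 1
            then show ?thesis using x unfolding S_def
              by (simp add: scale_def inner_Pair inner_diff_left inner_add_left algebra_simps corner_def)
          next
            case 2
            then show ?thesis using y[of u] by (auto simp: scale_def corner_def)
          qed
        qed
      qed (use c_pos in auto)
      then show ?thesis using amp_pos[of k] by (simp add: atom_def)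
    qed
    then have "atom k (x + real M *\<^sub>R h, y) \<noteq> 0" using amp_pos[of k] c_pos
      by (smt (verit) mult_pos_pos zero_less_power)
    moreover have "\<bar>(real M *\<^sub>R h) \<bullet> e0\<bar> \<le> real M"
      using e0 freq_ge_1[of k] by (simp add: h_def divide_le_eq mult_le_cancel_left1)
    ultimately have k: "block x = k" by (rule block_eqI)
    have low: "atom k (x + real j *\<^sub>R h, y) = 0" if "j < M" for j
    proof -
      have e: "(e0, 0) \<in> (Basis :: ('a \<times> 'b) set)" using e0 by (simp add: Basis_prod_def)
      have "scale k (e0, 0) * (((x + real j *\<^sub>R h, y) - corner k) \<bullet> (e0, 0))
          = freq k * ((x - (fst (corner k) - real M *\<^sub>R h)) \<bullet> e0) - (real M - real j)"
        using e0 freq_pos[of k]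
        by (simp add: scale_def corner_def h_def inner_diff_left inner_add_left field_simps)
      also have "\<dots> < 0" using x e0 \<open>j < M\<close> unfolding S_def by force
      finally show ?thesis
        using box_bump_support[OF _ e, of "scale k" "corner k" "(x + real j *\<^sub>R h, y)"]
        by (force simp: atom_def)
    qed
    have "diff_op M h (\<lambda>x. example (x, y)) x = diff_op M (h, 0) example (x, y)"
      by (simp add: diff_op_def)
    also have "\<dots> = diff_op M (h, 0) (atom k) (x, y)"
      by (simp add: diff_op_example[OF nh order_refl] k)
    also have "\<dots> = (\<Sum>j\<in>{M}. (-1) ^ (M - j) * real (M choose j) * atom k ((x, y) + real j *\<^sub>R (h, 0)))"
      unfolding diff_op_def by (intro sum.mono_neutral_right) (auto simp: low)
    finally show ?thesis using top by simp
  qed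
  have "ennreal ((a k * c ^ DIM('a \<times> 'b)) powr P * (1/2) ^ DIM('a) * freq k powr (- (s * P)))
      = ennreal ((amp k * c ^ DIM('a \<times> 'b)) powr P) * ennreal ((1 / (2 * freq k)) ^ DIM('a))"
  proof -
    have "(freq k powr (real DIM('a) / P - s)) powr P = freq k ^ DIM('a) * freq k powr (- (s * P))"
    proof -
      have "(real DIM('a) / P - s) * P = real DIM('a) - s * P" using P by (simp add: left_diff_distrib)
      then have "(freq k powr (real DIM('a) / P - s)) powr P = freq k powr (real DIM('a) - s * P)"
        by (simp only: powr_powr)
      then show ?thesis
        using freq_pos[of k] by (simp add: powr_diff powr_realpow powr_minus divide_inverse)
    qed
    then have "(amp k * c ^ DIM('a \<times> 'b)) powr P * (1 / (2 * freq k)) ^ DIM('a) =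
      (a k * c ^ DIM('a \<times> 'b)) powr P * (1/2) ^ DIM('a) * freq k powr (- (s * P))"
      using freq_pos[of k] a[of k] c_pos unfolding amp_def
      by (simp add: powr_mult power_mult_distrib power_divide)
    then show ?thesis using freq_pos[of k] by (simp add: ennreal_mult'[symmetric])
  qed
  also have "\<dots> = (\<integral>\<^sup>+x. ennreal ((amp k * c ^ DIM('a \<times> 'b)) powr P) * indicator S x \<partial>lborel)"
    using S by (simp add: nn_integral_cmult_indicator)
  also have "\<dots> \<le> (\<integral>\<^sup>+x. ennreal (\<bar>diff_op M h (\<lambda>x. example (x, y)) x\<bar> powr P) \<partial>lborel)"
  proof (rule nn_integral_mono)
    fix x
    have "(amp k * c ^ DIM('a \<times> 'b)) powr P \<le> \<bar>diff_op M h (\<lambda>x. example (x, y)) x\<bar> powr P" if "x \<in> S"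
      using val[OF that] amp_pos[of k] c_pos P by (intro powr_mono2 mult_nonneg_nonneg) auto
    then show "ennreal ((amp k * c ^ DIM('a \<times> 'b)) powr P) * indicator S x
        \<le> ennreal (\<bar>diff_op M h (\<lambda>x. example (x, y)) x\<bar> powr P)"
      by (cases "x \<in> S") (auto simp: ennreal_leI)
  qed
  finally show ?thesis unfolding h_def .
qed

end

section \<open>Cubes that visit every point at unbounded heights\<close>

lemma shrinking_mesh_exists:
  fixes A \<theta> \<epsilon> :: real
  assumes "\<theta> > 0" "\<epsilon> > 0" "A > 0"
  shows "\<exists>L::nat. L \<ge> 1 \<and> A * real L powr (- \<theta>) \<le> \<epsilon>"
proof -
  obtain L :: nat where L: "max 1 ((A / \<epsilon>) powr (1 / \<theta>)) \<le> real L" using real_arch_simple by blast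
  then have "((A / \<epsilon>) powr (1 / \<theta>)) powr \<theta> \<le> real L powr \<theta>"
    using assms by (intro powr_mono2) auto
  then have "A / \<epsilon> \<le> real L powr \<theta>" using assms by (simp add: powr_powr)
  moreover have "real L powr \<theta> > 0" using L by simp
  ultimately have "A * real L powr (- \<theta>) \<le> \<epsilon>"
    using assms by (simp add: powr_minus field_simps)
  then show ?thesis using L by (intro exI[of _ L]) auto
qed

text \<open>In generation \<open>m\<close> all cubes have side \<open>1 / L m\<close> and height \<open>m + 1\<close>, and their corners run through
the lattice of half that mesh, so that the middle halves \<open>[1/4, 3/4]\<^sup>n\<close> of the cubes already cover all points with
coordinates up to \<open>m + 1\<close>. There are at most \<open>(9 (m + 1) L)\<^sup>n\<close> of them, each contributing
\<open>((m + 1)\<^sup>P L\<^sup>-\<^sup>n)\<^sup>\<rho>\<close>, and since \<open>\<rho> > 1\<close> the mesh \<open>L = L m\<close> can be chosen so fine that the generation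
contributes at most \<open>2\<^sup>-\<^sup>m\<close>. The cubes of all generations are then put into one sequence.\<close>

lemma recurrent_cubes_exist:
  assumes "P > 0" "\<rho> > 1"
  shows "\<exists>(\<eta> :: nat \<Rightarrow> 'b::euclidean_space) r a.
    (\<forall>k. 0 < r k \<and> r k \<le> 1 \<and> 0 < a k) \<and>
    summable (\<lambda>k. (a k powr P * r k ^ DIM('b)) powr \<rho>) \<and>
    (\<forall>y C. \<exists>k. C \<le> a k \<and> (\<forall>b\<in>Basis. (y - \<eta> k) \<bullet> b / r k \<in> {1/4..3/4}))"
proof -
  define n where "n = DIM('b)"
  have n: "n > 0" by (simp add: n_def)
  have "\<exists>L::nat. L \<ge> 1 \<and> ((9 * (real m + 1)) ^ n * (real m + 1) powr (P * \<rho>)) * real L powr (- (real n * (\<rho> - 1))) \<le> (1/2) ^ m" for m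
    using assms n by (intro shrinking_mesh_exists) auto
  then obtain L :: "nat \<Rightarrow> nat" where L: "\<And>m. L m \<ge> 1"
    and Lb: "\<And>m. ((9 * (real m + 1)) ^ n * (real m + 1) powr (P * \<rho>)) * real (L m) powr (- (real n * (\<rho> - 1))) \<le> (1/2) ^ m"
    by metis
  \<comment> \<open>A corner has coordinates \<open>g b / (2 L)\<close> with integers \<open>g b\<close>; this range of \<open>g b\<close> suffices for
    the points with coordinates up to \<open>m + 1\<close>.\<close>
  define J where "J m = 4 * int (Suc m) * int (L m)" for m
  define Z where "Z m = (Basis :: 'b set) \<rightarrow>\<^sub>E {- J m .. J m}" for m
  have finZ: "finite (Z m)" for m unfolding Z_def by (intro finite_PiE) auto
  have J0: "J m \<ge> 0" for m by (simp add: J_def)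
  have cardZ: "real (card (Z m)) = (2 * real_of_int (J m) + 1) ^ n" for m
    unfolding Z_def n_def using J0[of m] by (simp add: card_PiE)
  define I where "I = (SIGMA m:UNIV. Z m)"
  have "countable I" unfolding I_def using finZ by (intro countable_SIGMA) (auto intro: countable_finite)
  moreover have "infinite I"
  proof
    assume "finite I"
    moreover have "(UNIV :: nat set) \<subseteq> fst ` I"
    proof
      fix m :: nat
      have "(\<lambda>b\<in>Basis. 0) \<in> Z m" using J0[of m] by (auto simp: Z_def)
      then show "m \<in> fst ` I" unfolding I_def by force
    qed
    ultimately show False using finite_surj infinite_UNIV_nat by blast
  qed
  ultimately have bij: "bij_betw (from_nat_into I) UNIV I" by (rule bij_betw_from_nat_into)
  define e where "e = from_nat_into I"
  define r where "r k = 1 / real (L (fst (e k)))" for k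
  define a where "a k = real (fst (e k)) + 1" for k
  define \<eta> where "\<eta> k = (\<Sum>b\<in>Basis. (r k * real_of_int (snd (e k) b) / 2) *\<^sub>R b)" for k :: nat
  define W where "W m = ((real m + 1) powr P * (1 / real (L m)) ^ n) powr \<rho>" for m
  have card_W: "real (card (Z m)) * W m \<le> (1/2) ^ m" for m
  proof -
    have l: "real (L m) \<ge> 1" using L[of m] by simp
    have "(2 * real_of_int (J m) + 1) ^ n \<le> (9 * (real m + 1) * real (L m)) ^ n"
    proof (rule power_mono)
      have "1 * 1 \<le> (real m + 1) * real (L m)" using l by (intro mult_mono) auto
      then show "2 * real_of_int (J m) + 1 \<le> 9 * (real m + 1) * real (L m)" by (simp add: J_def algebra_simps)
    qed (use J0[of m] in auto)
    also have "\<dots> = (9 * (real m + 1)) ^ n * real (L m) powr real n"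
      using l by (simp add: power_mult_distrib powr_realpow)
    finally have 1: "real (card (Z m)) \<le> (9 * (real m + 1)) ^ n * real (L m) powr real n"
      unfolding cardZ .
    have "(1 / real (L m)) ^ n = real (L m) powr - real n"
      using l by (simp add: powr_minus_divide powr_realpow power_one_over)
    then have 2: "W m = (real m + 1) powr (P * \<rho>) * real (L m) powr (- (real n * \<rho>))"
      unfolding W_def by (simp add: powr_mult powr_powr)
    have "real (card (Z m)) * W m \<le> ((9 * (real m + 1)) ^ n * real (L m) powr real n) * W m"
      using 1 by (intro mult_right_mono) (auto simp: W_def)
    also have "\<dots> = ((9 * (real m + 1)) ^ n * (real m + 1) powr (P * \<rho>)) * (real (L m) powr real n * real (L m) powr (- (real n * \<rho>)))"
      unfolding 2 by (simp only: mult_ac)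
    also have "real (L m) powr real n * real (L m) powr (- (real n * \<rho>)) = real (L m) powr (- (real n * (\<rho> - 1)))"
      by (simp add: powr_add[symmetric] algebra_simps)
    finally show ?thesis using Lb[of m] by linarith
  qed
  show ?thesis
  proof (rule exI[of _ \<eta>], rule exI[of _ r], rule exI[of _ a], intro conjI allI)
    show "0 < r k" "r k \<le> 1" "0 < a k" for k
      using L[of "fst (e k)"] by (auto simp: r_def a_def)
    show "summable (\<lambda>k. (a k powr P * r k ^ DIM('b)) powr \<rho>)"
    proof (rule summableI_nonneg_bounded)
      fix N
      have inj: "inj_on e {..<N}" using bij unfolding e_def bij_betw_def by (auto intro: inj_on_subset)
      define T where "T = Max (fst ` e ` {..<N} \<union> {0})"
      have sub: "e ` {..<N} \<subseteq> (SIGMA m:{..T}. Z m)"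
      proof
        fix z assume z: "z \<in> e ` {..<N}"
        then have "fst z \<le> T" unfolding T_def by (intro Max_ge) auto
        moreover have "z \<in> I" using z bij unfolding e_def bij_betw_def by auto
        ultimately show "z \<in> (SIGMA m:{..T}. Z m)" unfolding I_def by auto
      qed
      have "(\<Sum>k<N. (a k powr P * r k ^ DIM('b)) powr \<rho>) = (\<Sum>k<N. W (fst (e k)))"
        by (simp add: W_def a_def r_def n_def)
      also have "\<dots> = (\<Sum>z\<in>e ` {..<N}. W (fst z))" using inj by (simp add: sum.reindex)
      also have "\<dots> \<le> (\<Sum>z\<in>(SIGMA m:{..T}. Z m). W (fst z))"
        using finZ by (intro sum_mono2 sub) (auto simp: W_def)
      also have "\<dots> = (\<Sum>m\<le>T. \<Sum>g\<in>Z m. W m)"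
        using finZ by (subst sum.Sigma) (auto simp: split_beta)
      also have "\<dots> = (\<Sum>m\<le>T. real (card (Z m)) * W m)" by simp
      also have "\<dots> \<le> (\<Sum>m\<le>T. (1/2) ^ m)" by (intro sum_mono card_W)
      also have "\<dots> \<le> (\<Sum>m. (1/2) ^ m)" by (intro sum_le_suminf summable_geometric) auto
      also have "\<dots> = 2" by (subst suminf_geometric) auto
      finally show "(\<Sum>k<N. (a k powr P * r k ^ DIM('b)) powr \<rho>) \<le> 2" .
    qed simp
    fix y :: 'b and C :: real
    obtain m :: nat where "max C (norm y) \<le> real m" using real_arch_simple by blast
    then have m: "C \<le> real m + 1" "norm y \<le> real m + 1" by auto
    \<comment> \<open>With this \<open>g\<close> the rescaled coordinate \<open>L y - g / 2\<close> lies in \<open>[1/4, 3/4)\<close>.\<close>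
    define g where "g = (\<lambda>b\<in>Basis. \<lfloor>2 * real (L m) * (y \<bullet> b) - 1 / 2\<rfloor>)"
    have "g \<in> Z m"
      unfolding Z_def g_def
    proof (rule restrict_PiE_iff[THEN iffD2], intro ballI)
      fix b :: 'b assume b: "b \<in> Basis"
      have l: "real (L m) \<ge> 1" using L[of m] by simp
      have "real (L m) * \<bar>y \<bullet> b\<bar> \<le> real (L m) * (real m + 1)"
        using Basis_le_norm[OF b, of y] m by (intro mult_left_mono) auto
      moreover have "real (L m) * \<bar>y \<bullet> b\<bar> = \<bar>real (L m) * (y \<bullet> b)\<bar>" by (simp add: abs_mult)
      moreover have "1 * 1 \<le> real (L m) * (real m + 1)" using l by (intro mult_mono) auto
      ultimately have "\<bar>2 * real (L m) * (y \<bullet> b) - 1 / 2\<bar> + 1 \<le> 4 * (real (L m) * (real m + 1))"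
        by linarith
      also have "\<dots> = real_of_int (J m)" by (simp add: J_def algebra_simps)
      finally have "\<bar>2 * real (L m) * (y \<bullet> b) - 1 / 2\<bar> + 1 \<le> real_of_int (J m)" .
      then show "\<lfloor>2 * real (L m) * (y \<bullet> b) - 1 / 2\<rfloor> \<in> {- J m..J m}" by simp linarith
    qed
    then have "(m, g) \<in> I" by (simp add: I_def)
    then obtain k where k: "e k = (m, g)" using bij unfolding e_def bij_betw_def by (metis imageE)
    have "(y - \<eta> k) \<bullet> b / r k \<in> {1/4..3/4}" if b: "b \<in> Basis" for b
    proof -
      have "real (L m) > 0" using L[of m] by simp
      then have "(y - \<eta> k) \<bullet> b / r k = real (L m) * (y \<bullet> b) - real_of_int \<lfloor>2 * real (L m) * (y \<bullet> b) - 1 / 2\<rfloor> / 2"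
        using b by (simp add: \<eta>_def r_def k inner_diff_left g_def field_simps)
      then show ?thesis by simp linarith
    qed
    then show "\<exists>k. C \<le> a k \<and> (\<forall>b\<in>Basis. (y - \<eta> k) \<bullet> b / r k \<in> {1/4..3/4})"
      using m by (intro exI[of _ k]) (auto simp: a_def k)
  qed
qed

section \<open>Real powers and the discrete Schur test\<close>

lemma ennpowr_ennreal: "x \<ge> 0 \<Longrightarrow> ennpowr (ennreal x) b = ennreal (x powr b)"
  by (simp add: ennpowr_def)

lemma ennpowr_less_top: "x < \<infinity> \<Longrightarrow> ennpowr x b < \<infinity>"
  by (simp add: ennpowr_def)

lemma ennpowr_mono:
  assumes "x \<le> y" "b \<ge> 0"
  shows "ennpowr x b \<le> ennpowr y b"
proof (cases y)
  case (real v)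
  then obtain u where "x = ennreal u" "u \<ge> 0" "u \<le> v"
    using assms(1) by (cases x) (auto simp: top_unique)
  then show ?thesis using real assms(2) by (simp add: ennpowr_ennreal ennreal_leI powr_mono2)
qed (simp add: ennpowr_def)

lemma ennpowr_ennpowr:
  assumes "b > 0" "c > 0"
  shows "ennpowr (ennpowr x b) c = ennpowr x (b * c)"
  by (cases x) (use assms in \<open>auto simp: ennpowr_ennreal powr_powr, simp add: ennpowr_def\<close>)

lemma ennpowr_cmult:
  assumes "x > 0" "b > 0"
  shows "ennpowr (ennreal x * y) b = ennreal (x powr b) * ennpowr y b"
proof (cases y)
  case (real v)
  then show ?thesis using assms by (simp add: ennreal_mult[symmetric] ennpowr_ennreal powr_mult)
next
  case top
  then show ?thesis using assms by (simp add: ennpowr_def ennreal_mult_top)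
qed

text \<open>A convexity-free form of the Schur test. Every term of the right-hand sum is at most the sum
\<open>S\<close>, which gives \<open>w k * v k powr (1/2) \<le> S powr (1 / \<rho>)\<close>; the other half of the weight \<open>v k\<close> makes
the series converge. Giving away half of the decay costs nothing below, and the
argument works for every \<open>\<rho> > 0\<close>.\<close>

lemma ennpowr_suminf_le:
  fixes w v :: "nat \<Rightarrow> real"
  assumes w: "\<And>k. w k \<ge> 0" and v: "\<And>k. v k \<ge> 0" and "\<rho> > 0" "C > 0"
    and C: "(\<Sum>k. ennreal (v k powr (1/2))) \<le> ennreal C"
  shows "ennpowr (\<Sum>k. ennreal (w k * v k)) \<rho>
    \<le> ennreal (C powr \<rho>) * (\<Sum>k. ennreal (w k powr \<rho> * v k powr (\<rho> / 2)))"
proof (cases "\<Sum>k. ennreal (w k powr \<rho> * v k powr (\<rho> / 2))")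
  case top
  then show ?thesis using \<open>C > 0\<close> by (simp add: ennreal_mult_top)
next
  case (real S)
  have "w k * v k powr (1/2) \<le> S powr (1 / \<rho>)" for k
  proof -
    have "ennreal (w k powr \<rho> * v k powr (\<rho> / 2)) \<le> ennreal S"
      unfolding real(2)[symmetric] by (rule term_le_suminf)
    then have "w k powr \<rho> * v k powr (\<rho> / 2) \<le> S" using real(1) by simp
    then have "(w k * v k powr (1/2)) powr \<rho> \<le> S" using w[of k] v[of k] by (simp add: powr_mult powr_powr)
    then have "((w k * v k powr (1/2)) powr \<rho>) powr (1 / \<rho>) \<le> S powr (1 / \<rho>)"
      using \<open>\<rho> > 0\<close> by (intro powr_mono2) auto
    then show ?thesis using \<open>\<rho> > 0\<close> w[of k] by (simp add: powr_powr)
  qed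
  then have "w k * v k \<le> S powr (1 / \<rho>) * v k powr (1/2)" for k
    using mult_right_mono[of "w k * v k powr (1/2)" "S powr (1 / \<rho>)" "v k powr (1/2)"] v[of k]
    by (simp add: mult.assoc powr_add[symmetric])
  then have "(\<Sum>k. ennreal (w k * v k)) \<le> (\<Sum>k. ennreal (S powr (1 / \<rho>)) * ennreal (v k powr (1/2)))"
    by (intro suminf_le summableI) (simp add: ennreal_mult[symmetric] ennreal_leI)
  also have "\<dots> \<le> ennreal (S powr (1 / \<rho>)) * ennreal C"
    using C by (simp add: mult_left_mono)
  also have "\<dots> = ennreal (S powr (1 / \<rho>) * C)" using \<open>C > 0\<close> by (simp add: ennreal_mult)
  finally have "ennpowr (\<Sum>k. ennreal (w k * v k)) \<rho> \<le> ennpowr (ennreal (S powr (1 / \<rho>) * C)) \<rho>"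
    using \<open>\<rho> > 0\<close> by (intro ennpowr_mono) auto
  also have "\<dots> = ennreal (C powr \<rho>) * ennreal S"
    using \<open>C > 0\<close> \<open>\<rho> > 0\<close> real(1)
    by (subst ennpowr_ennreal) (simp_all add: powr_mult powr_powr ennreal_mult mult.commute)
  finally show ?thesis unfolding real(2) .
qed

lemma suminf_swap_ennreal:
  fixes f :: "nat \<Rightarrow> nat \<Rightarrow> ennreal"
  shows "(\<Sum>i. \<Sum>k. f i k) = (\<Sum>k. \<Sum>i. f i k)"
proof -
  have "(\<Sum>i. \<Sum>k. f i k) = (\<Sum>i. \<integral>\<^sup>+k. f i k \<partial>count_space UNIV)"
    by (simp add: nn_integral_count_space_nat)
  also have "\<dots> = (\<integral>\<^sup>+k. (\<Sum>i. f i k) \<partial>count_space UNIV)"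
    by (rule nn_integral_suminf[symmetric]) simp
  finally show ?thesis by (simp add: nn_integral_count_space_nat)
qed

lemma dyadic_shell:
  fixes t :: real
  assumes "0 < t" "t \<le> 1"
  obtains i :: nat where "1 / 2 ^ Suc i < t" "t \<le> 1 / 2 ^ i"
proof -
  define n where "n = (LEAST n. (1/2) ^ n < t)"
  have ex: "\<exists>n. (1/2) ^ n < t" using assms(1) by (intro real_arch_pow_inv) auto
  have n: "(1/2) ^ n < t" unfolding n_def using ex by (rule LeastI_ex)
  have "n \<noteq> 0" using n assms(2) by (cases n) auto
  then obtain i where i: "n = Suc i" by (cases n) auto
  have "\<not> (1/2) ^ i < t" using not_less_Least[of i "\<lambda>n. (1/2) ^ n < t"] i unfolding n_def by simp
  then show thesis using that[of i] n i by (simp add: power_one_over)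
qed

lemma Lp_norm_finite:
  assumes "p \<noteq> \<infinity>"
  shows "Lp_norm p f = ennpowr (\<integral>\<^sup>+x. ennreal (\<bar>f x\<bar> powr enn2real p) \<partial>lborel) (1 / enn2real p)"
  using assms by (simp add: Lp_norm_def nn_integral_completion)

section \<open>Besov membership of the sum and of its slices\<close>

context lacunary_atoms
begin

text \<open>For \<open>y\<close> in the middle of the \<open>k\<close>-th cube, the step \<open>e0 / freq k\<close> alone shows that the seminorm is at
least a fixed multiple of \<open>a k\<close>.\<close>

lemma slice_not_besov:
  assumes p: "p \<noteq> \<infinity>" "enn2real p = P"
    and y: "\<And>C. \<exists>k. C \<le> a k \<and> (\<forall>b\<in>Basis. (y - \<eta> k) \<bullet> b / r k \<in> {1/4..3/4})"
  shows "(\<lambda>x. example (x, y)) \<notin> besov_space M s p \<infinity>"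
proof
  assume "(\<lambda>x. example (x, y)) \<in> besov_space M s p \<infinity>"
  then have "besov_seminorm M s p \<infinity> (\<lambda>x. example (x, y)) < \<infinity>" by (simp add: besov_space_def)
  then obtain B where B: "B \<ge> 0" "besov_seminorm M s p \<infinity> (\<lambda>x. example (x, y)) = ennreal B"
    by (cases "besov_seminorm M s p \<infinity> (\<lambda>x. example (x, y))") auto
  define c' where "c' = c ^ DIM('a \<times> 'b) * ((1/2) ^ DIM('a)) powr (1 / P)"
  have c': "c' > 0" unfolding c'_def using c_pos by (intro mult_pos_pos) auto
  obtain k where k: "(B + 1) / c' \<le> a k" "\<And>b. b \<in> Basis \<Longrightarrow> (y - \<eta> k) \<bullet> b / r k \<in> {1/4..3/4}"
    using y by blast
  define h where "h = (1 / freq k) *\<^sub>R e0"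
  have nh: "norm h = 1 / freq k" using e0 freq_pos[of k] by (simp add: h_def)
  let ?I = "\<integral>\<^sup>+x. ennreal (\<bar>diff_op M h (\<lambda>x. example (x, y)) x\<bar> powr P) \<partial>lborel"
  have u: "(a k * c ^ DIM('a \<times> 'b)) powr P * (1/2) ^ DIM('a) * freq k powr (- (s * P)) =
      (a k * c' * freq k powr (- s)) powr P"
    using a[of k] c_pos P unfolding c'_def by (simp add: powr_mult powr_powr mult_ac)
  have "ennreal (a k * c' * freq k powr (- s)) = ennpowr (ennreal ((a k * c' * freq k powr (- s)) powr P)) (1 / P)"
    using a[of k] c' P by (simp add: ennpowr_ennreal powr_powr)
  also have "\<dots> \<le> ennpowr ?I (1 / P)"
    using slice_diff_integral[OF k(2)] P unfolding u h_def by (intro ennpowr_mono) auto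
  also have "\<dots> = Lp_norm p (diff_op M h (\<lambda>x. example (x, y)))"
    using p by (simp add: Lp_norm_finite)
  finally have "ennreal (norm h powr (- s)) * ennreal (a k * c' * freq k powr (- s))
      \<le> ennreal (norm h powr (- s)) * Lp_norm p (diff_op M h (\<lambda>x. example (x, y)))"
    by (rule mult_left_mono) simp
  also have "\<dots> \<le> (SUP h\<in>{h::'a. 0 < norm h \<and> norm h \<le> 1}. ennreal (norm h powr (- s)) * Lp_norm p (diff_op M h (\<lambda>x. example (x, y))))"
  proof (intro SUP_upper CollectI conjI)
    show "0 < norm h" "norm h \<le> 1"
      unfolding nh using freq_pos[of k] freq_ge_1[of k] by (auto simp: divide_le_eq)
  qed
  also have "\<dots> = ennreal B" using B(2) by (simp add: besov_seminorm_def)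
  finally have "ennreal (norm h powr (- s) * (a k * c' * freq k powr (- s))) \<le> ennreal B"
    by (simp add: ennreal_mult')
  then have "norm h powr (- s) * (a k * c' * freq k powr (- s)) \<le> B" using B(1) by simp
  moreover have "norm h powr (- s) * (a k * c' * freq k powr (- s)) = a k * c'"
    unfolding nh using freq_pos[of k] by (simp add: powr_divide powr_minus field_simps)
  ultimately show False using k(1) c' by (simp add: divide_le_eq)
qed

lemma weighted_decay_sum_le:
  assumes "\<And>k. weight k \<le> B" "t > 0"
  shows "(\<Sum>k. ennreal (weight k * decay rate (freq k * t))) \<le> ennreal (B * (decay_bound rate))"
proof -
  have B: "B \<ge> 0" using assms(1)[of 0] weight_nonneg[of 0] by linarith
  have "(\<Sum>k. ennreal (weight k * decay rate (freq k * t))) \<le> (\<Sum>k. ennreal B * ennreal (decay rate (freq k * t)))"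
    using assms B decay_nonneg
    by (intro suminf_le summableI) (auto simp: ennreal_mult[symmetric] intro!: ennreal_leI mult_right_mono)
  also have "\<dots> = ennreal B * (\<Sum>k. ennreal (decay rate (freq k * t)))" by simp
  also have "\<dots> \<le> ennreal B * ennreal (decay_bound rate)"
  proof (intro mult_left_mono suminf_decay_le rate_pos)
    show "0 < freq k * t" "2 * (freq k * t) \<le> freq (Suc k) * t" for k
      using freq_pos[of k] freq_Suc[of k] \<open>t > 0\<close> mult_right_mono[of "2 * freq k" "freq (Suc k)" t] by auto
  qed simp
  also have "\<dots> = ennreal (B * (decay_bound rate))"
    using B by (rule ennreal_mult'[symmetric])
  finally show ?thesis .
qed

lemma example_Lp:
  assumes p: "p \<noteq> \<infinity>" "enn2real p = P" and B: "\<And>k. weight k \<le> B"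
  shows "example \<in> Lp_space p"
proof -
  have "(\<integral>\<^sup>+z. ennreal (\<bar>example z\<bar> powr P) \<partial>lborel) \<le> ennreal atom_const * ennreal (B * (decay_bound rate))"
    using weighted_decay_sum_le[OF B, of 1] by (intro order_trans[OF example_bound] mult_left_mono) auto
  also have "\<dots> < \<infinity>" by (simp add: ennreal_mult_less_top)
  finally have "(\<integral>\<^sup>+z. ennreal (\<bar>example z\<bar> powr P) \<partial>lborel) \<noteq> \<infinity>" by simp
  then have "Lp_norm p example < \<infinity>"
    using p by (simp add: Lp_norm_finite ennpowr_def)
  then show ?thesis using example_borel by (simp add: Lp_space_def measurable_completion)
qed

lemma example_seminorm_infinity:
  assumes p: "p \<noteq> \<infinity>" "enn2real p = P" and B: "\<And>k. weight k \<le> B"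
  shows "besov_seminorm M s p \<infinity> example < \<infinity>"
proof -
  define C where "C = max 1 (atom_const * (B * (decay_bound rate)))"
  have "ennreal (norm h powr (- s)) * Lp_norm p (diff_op M h example) \<le> ennreal (C powr (1 / P))"
    if h: "0 < norm h" "norm h \<le> 1" for h
  proof -
    have "(\<integral>\<^sup>+z. ennreal (\<bar>diff_op M h example z\<bar> powr P) \<partial>lborel)
        \<le> ennreal (atom_const * norm h powr (s * P)) * ennreal (B * (decay_bound rate))"
      using weighted_decay_sum_le[OF B h(1)] by (intro order_trans[OF example_diff_bound[OF h]] mult_left_mono) auto
    also have "\<dots> = ennreal (norm h powr (s * P) * (atom_const * (B * (decay_bound rate))))"
      by (subst ennreal_mult'[symmetric]) (simp_all add: atom_const_nonneg mult_ac)
    also have "\<dots> \<le> ennreal (norm h powr (s * P) * C)"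
      unfolding C_def by (intro ennreal_leI mult_left_mono) auto
    finally have "Lp_norm p (diff_op M h example) \<le> ennpowr (ennreal (norm h powr (s * P) * C)) (1 / P)"
      using p P by (simp add: Lp_norm_finite ennpowr_mono)
    also have "\<dots> = ennreal (norm h powr s * C powr (1 / P))"
      using P C_def by (simp add: ennpowr_ennreal powr_mult powr_powr)
    finally have "ennreal (norm h powr (- s)) * Lp_norm p (diff_op M h example)
        \<le> ennreal (norm h powr (- s)) * ennreal (norm h powr s * C powr (1 / P))"
      by (rule mult_left_mono) simp
    also have "\<dots> = ennreal (C powr (1 / P))"
      using h(1) by (simp add: ennreal_mult'[symmetric] powr_minus)
    finally show ?thesis .
  qed
  then have "besov_seminorm M s p \<infinity> example \<le> ennreal (C powr (1 / P))"
    unfolding besov_seminorm_def by (auto intro!: SUP_least)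
  then show ?thesis by (rule le_less_trans) simp
qed

text \<open>Up to a constant, this bounds the contribution of the shell \<open>1 / 2 ^ Suc i < |h| \<le> 1 / 2 ^ i\<close> to the
\<open>q\<close>-th power of the seminorm, where \<open>q = P \<rho>\<close>.\<close>

definition shell_sum :: "real \<Rightarrow> nat \<Rightarrow> ennreal" where
  "shell_sum \<rho> i = (\<Sum>k. ennreal (weight k powr \<rho> * decay (rate * \<rho> / 2) (freq k / 2 ^ i)))"

text \<open>After exchanging the sums, the decay is summed over the shells for fixed \<open>k\<close>. The sequence
\<open>2\<^sup>i / freq k\<close> is doubling as well, so the bound does not depend on \<open>k\<close>.\<close>

lemma suminf_shell_sum:
  assumes "\<rho> > 0" and "summable (\<lambda>k. weight k powr \<rho>)"
  shows "(\<Sum>i. shell_sum \<rho> i) < \<infinity>"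
proof -
  define \<tau> where "\<tau> = rate * \<rho> / 2"
  have \<tau>: "\<tau> > 0" using rate_pos assms(1) by (simp add: \<tau>_def)
  define C where "C = decay_bound \<tau>"
  have "(\<Sum>i. shell_sum \<rho> i) = (\<Sum>k. \<Sum>i. ennreal (weight k powr \<rho> * decay \<tau> (freq k / 2 ^ i)))"
    unfolding shell_sum_def \<tau>_def by (rule suminf_swap_ennreal)
  also have "\<dots> = (\<Sum>k. ennreal (weight k powr \<rho>) * (\<Sum>i. ennreal (decay \<tau> (freq k / 2 ^ i))))"
    by (simp only: ennreal_mult'[OF powr_ge_zero] ennreal_suminf_cmult)
  also have "\<dots> \<le> (\<Sum>k. ennreal (weight k powr \<rho>) * ennreal C)"
  proof (intro suminf_le summableI mult_left_mono)
    fix k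
    have "decay \<tau> (freq k / 2 ^ i) = decay \<tau> (2 ^ i / freq k)" for i
      using decay_inverse[of \<tau> "freq k / 2 ^ i"] by simp
    moreover have "(\<Sum>i. ennreal (decay \<tau> (2 ^ i / freq k))) \<le> ennreal C"
      unfolding C_def using freq_pos[of k] by (intro suminf_decay_le \<tau>) auto
    ultimately show "(\<Sum>i. ennreal (decay \<tau> (freq k / 2 ^ i))) \<le> ennreal C" by simp
  qed simp
  also have "\<dots> = (\<Sum>k. ennreal (weight k powr \<rho>)) * ennreal C" by simp
  also have "\<dots> < \<infinity>"
  proof -
    have "(\<Sum>k. ennreal (weight k powr \<rho>)) \<noteq> top" by (rule ennreal_suminf_neq_top[OF assms(2)]) simp
    then have "(\<Sum>k. ennreal (weight k powr \<rho>)) < top" by (simp only: less_top)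
    then show ?thesis unfolding infinity_ennreal_def by (rule ennreal_mult_less_top[THEN iffD2, OF disjI2, OF disjI2, OF conjI]) simp
  qed
  finally show ?thesis .
qed

text \<open>Half of the decay is spent on the sum over the atoms, by the Schur test; the other half remains in
the shell sum and makes it summable over the shells.\<close>

lemma example_diff_shell:
  assumes "\<rho> > 0"
  shows "\<exists>D>0. \<forall>i h. 1 / 2 ^ Suc i < norm h \<longrightarrow> norm h \<le> 1 / 2 ^ i \<longrightarrow>
      ennpowr (\<integral>\<^sup>+z. ennreal (\<bar>diff_op M h example z\<bar> powr P) \<partial>lborel) \<rho>
      \<le> ennreal (D * norm h powr (s * P * \<rho>)) * shell_sum \<rho> i"
proof -
  define C where "C = decay_bound (rate / 2)"
  have C: "C > 0" unfolding C_def using rate_pos by (intro decay_bound_pos) simp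
  define D where "D = (atom_const + 1) powr \<rho> * C powr \<rho> * 2 powr (rate * \<rho> / 2)"
  have "ennpowr (\<integral>\<^sup>+z. ennreal (\<bar>diff_op M h example z\<bar> powr P) \<partial>lborel) \<rho>
      \<le> ennreal (D * norm h powr (s * P * \<rho>)) * shell_sum \<rho> i"
    if h: "1 / 2 ^ Suc i < norm h" "norm h \<le> 1 / 2 ^ i" for i h
  proof -
    have "(0::real) < 1 / 2 ^ Suc i" "1 / 2 ^ i \<le> (1::real)" by (auto simp: divide_le_eq)
    then have h0: "0 < norm h" "norm h \<le> 1" using h by linarith+
    have pos: "freq k * norm h > 0" for k using freq_pos[of k] h0 by simp
    have "ennpowr (\<Sum>k. ennreal (weight k * decay rate (freq k * norm h))) \<rho>
        \<le> ennreal (C powr \<rho>) * (\<Sum>k. ennreal (weight k powr \<rho> * decay rate (freq k * norm h) powr (\<rho> / 2)))"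
    proof (rule ennpowr_suminf_le[OF weight_nonneg decay_nonneg assms C])
      show "(\<Sum>k. ennreal (decay rate (freq k * norm h) powr (1/2))) \<le> ennreal C"
        unfolding C_def decay_powr[OF pos] times_divide_eq_right mult_1_right
      proof (intro suminf_decay_le pos)
        show "2 * (freq k * norm h) \<le> freq (Suc k) * norm h" for k
          using freq_Suc[of k] mult_right_mono[of "2 * freq k" "freq (Suc k)" "norm h"] by auto
      qed (use rate_pos in auto)
    qed
    also have "(\<Sum>k. ennreal (weight k powr \<rho> * decay rate (freq k * norm h) powr (\<rho> / 2)))
        \<le> (\<Sum>k. ennreal (2 powr (rate * \<rho> / 2)) * ennreal (weight k powr \<rho> * decay (rate * \<rho> / 2) (freq k / 2 ^ i)))"
    proof (intro suminf_le summableI)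
      fix k
      have "decay (rate * \<rho> / 2) (freq k * norm h) \<le> 2 powr (rate * \<rho> / 2) * decay (rate * \<rho> / 2) (freq k / 2 ^ i)"
      proof (rule decay_le_decay[OF _ pos])
        show "0 < rate * \<rho> / 2" using rate_pos assms by simp
        show "freq k * norm h \<le> freq k / 2 ^ i"
          using mult_left_mono[OF h(2), of "freq k"] freq_pos[of k] by simp
        show "freq k / 2 ^ i \<le> 2 * (freq k * norm h)"
          using mult_left_mono[OF less_imp_le[OF h(1)], of "2 * freq k"] freq_pos[of k] by simp
      qed
      then have "weight k powr \<rho> * decay rate (freq k * norm h) powr (\<rho> / 2)
        \<le> weight k powr \<rho> * (2 powr (rate * \<rho> / 2) * decay (rate * \<rho> / 2) (freq k / 2 ^ i))"
        unfolding decay_powr[OF pos] by (intro mult_left_mono) auto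
      then show "ennreal (weight k powr \<rho> * decay rate (freq k * norm h) powr (\<rho> / 2))
        \<le> ennreal (2 powr (rate * \<rho> / 2)) * ennreal (weight k powr \<rho> * decay (rate * \<rho> / 2) (freq k / 2 ^ i))"
        by (simp add: ennreal_mult'[symmetric] ennreal_leI mult_ac)
    qed
    also have "\<dots> = ennreal (2 powr (rate * \<rho> / 2)) * shell_sum \<rho> i" by (simp add: shell_sum_def)
    finally have 1: "ennpowr (\<Sum>k. ennreal (weight k * decay rate (freq k * norm h))) \<rho>
        \<le> ennreal (C powr \<rho>) * (ennreal (2 powr (rate * \<rho> / 2)) * shell_sum \<rho> i)"
      by (simp add: mult_left_mono)
    have "(\<integral>\<^sup>+z. ennreal (\<bar>diff_op M h example z\<bar> powr P) \<partial>lborel)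
        \<le> ennreal ((atom_const + 1) * norm h powr (s * P)) * (\<Sum>k. ennreal (weight k * decay rate (freq k * norm h)))"
      using example_diff_bound[OF h0]
      by (rule order_trans) (intro mult_right_mono ennreal_leI, auto)
    then have "ennpowr (\<integral>\<^sup>+z. ennreal (\<bar>diff_op M h example z\<bar> powr P) \<partial>lborel) \<rho>
        \<le> ennpowr (ennreal ((atom_const + 1) * norm h powr (s * P)) * (\<Sum>k. ennreal (weight k * decay rate (freq k * norm h)))) \<rho>"
      using assms by (intro ennpowr_mono) auto
    also have "\<dots> = ennreal (((atom_const + 1) * norm h powr (s * P)) powr \<rho>) * ennpowr (\<Sum>k. ennreal (weight k * decay rate (freq k * norm h))) \<rho>"
      using assms atom_const_nonneg h0 by (intro ennpowr_cmult) auto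
    also have "\<dots> \<le> ennreal (((atom_const + 1) * norm h powr (s * P)) powr \<rho>) *
        (ennreal (C powr \<rho>) * (ennreal (2 powr (rate * \<rho> / 2)) * shell_sum \<rho> i))"
      using 1 by (intro mult_left_mono) auto
    also have "\<dots> = ennreal (D * norm h powr (s * P * \<rho>)) * shell_sum \<rho> i"
      using atom_const_nonneg unfolding D_def
      by (simp add: powr_mult powr_powr ennreal_mult' mult_ac)
    finally show ?thesis .
  qed
  moreover have "D > 0" unfolding D_def using C atom_const_nonneg by simp
  ultimately show ?thesis by (intro exI[of _ D] conjI allI impI)
qed

text \<open>The factor \<open>|h|\<^sup>s\<^sup>q\<close> gained in \<open>example_diff_shell\<close> cancels against the kernel of the seminorm and leaves
\<open>|h|\<^sup>-\<^sup>N\<close>, which is of the order \<open>2\<^sup>i\<^sup>N\<close> on the \<open>i\<close>-th shell and is compensated by the volume of the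
ball of radius \<open>2\<^sup>-\<^sup>i\<close>. What remains is the sum of the shell sums.\<close>

lemma example_seminorm_finite:
  assumes p: "p \<noteq> \<infinity>" "enn2real p = P" and q: "q \<noteq> \<infinity>" "enn2real q = P * \<rho>" and "\<rho> > 0"
    and sm: "summable (\<lambda>k. weight k powr \<rho>)"
  shows "besov_seminorm M s p q example < \<infinity>"
proof -
  define N where "N = DIM('a \<times> 'b)"
  define Q where "Q = P * \<rho>"
  have Q: "Q > 0" using P \<open>\<rho> > 0\<close> by (simp add: Q_def)
  obtain D where D: "D > 0" and shell: "\<And>i h. 1 / 2 ^ Suc i < norm h \<Longrightarrow> norm h \<le> 1 / 2 ^ i \<Longrightarrow>
      ennpowr (\<integral>\<^sup>+z. ennreal (\<bar>diff_op M h example z\<bar> powr P) \<partial>lborel) \<rho>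
      \<le> ennreal (D * norm h powr (s * P * \<rho>)) * shell_sum \<rho> i"
    using example_diff_shell[OF \<open>\<rho> > 0\<close>] by blast
  define G where "G h = ennpowr (Lp_norm p (diff_op M h example)) Q / ennreal (norm h powr (real N + s * Q))" for h :: "'a \<times> 'b"
  define E where "E i = ennreal (D * (2 ^ Suc i) ^ N) * shell_sum \<rho> i" for i
  have G: "G h \<le> E i" if h: "1 / 2 ^ Suc i < norm h" "norm h \<le> 1 / 2 ^ i" for i h
  proof -
    have "(0::real) < 1 / 2 ^ Suc i" by simp
    then have h0: "0 < norm h" using h by linarith
    have "ennpowr (Lp_norm p (diff_op M h example)) Q = ennpowr (\<integral>\<^sup>+z. ennreal (\<bar>diff_op M h example z\<bar> powr P) \<partial>lborel) \<rho>"
      using p P Q by (simp add: Lp_norm_finite ennpowr_ennpowr Q_def)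
    also have "\<dots> \<le> ennreal (D * norm h powr (s * P * \<rho>)) * shell_sum \<rho> i" by (rule shell[OF h])
    finally have "G h \<le> ennreal (D * norm h powr (s * P * \<rho>)) * shell_sum \<rho> i / ennreal (norm h powr (real N + s * Q))"
      unfolding G_def by (rule divide_right_mono_ennreal)
    also have "\<dots> = ennreal (D * norm h powr (s * P * \<rho>)) / ennreal (norm h powr (real N + s * Q)) * shell_sum \<rho> i"
      by (simp add: divide_ennreal_def mult_ac)
    also have "ennreal (D * norm h powr (s * P * \<rho>)) / ennreal (norm h powr (real N + s * Q)) = ennreal (D * (1 / norm h) ^ N)"
      using D h0 by (subst divide_ennreal) (auto simp: Q_def powr_add powr_realpow power_one_over mult_ac)
    also have "\<dots> \<le> ennreal (D * (2 ^ Suc i) ^ N)"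
    proof (intro ennreal_leI mult_left_mono power_mono)
      show "1 / norm h \<le> 2 ^ Suc i" using h(1) h0 by (simp add: field_simps)
    qed (use D in auto)
    finally show ?thesis unfolding E_def by (simp add: mult_right_mono)
  qed
  have "(\<integral>\<^sup>+h\<in>{h. norm h \<le> 1}. G h \<partial>lebesgue) = (\<integral>\<^sup>+h\<in>{h. norm h \<le> 1}. G h \<partial>lborel)"
    by (simp add: nn_integral_completion)
  also have "\<dots> \<le> (\<integral>\<^sup>+h. (\<Sum>i. E i * indicator (cball (0 :: 'a \<times> 'b) (1 / 2 ^ i)) h) \<partial>lborel)"
  proof (rule nn_integral_mono_AE)
    have "AE h in lborel. h \<noteq> (0 :: 'a \<times> 'b)" by (rule AE_lborel_singleton)
    then show "AE h in lborel. G h * indicator {h. norm h \<le> 1} h \<le> (\<Sum>i. E i * indicator (cball 0 (1 / 2 ^ i)) h)"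
    proof eventually_elim
      case (elim h)
      show ?case
      proof (cases "norm h \<le> 1")
        case True
        then obtain i where i: "1 / 2 ^ Suc i < norm h" "norm h \<le> 1 / 2 ^ i"
          using dyadic_shell[of "norm h"] elim by auto
        then have "G h * indicator {h. norm h \<le> 1} h \<le> E i * indicator (cball 0 (1 / 2 ^ i)) h"
          using G[OF i] True by (simp add: indicator_def)
        also have "\<dots> \<le> (\<Sum>i. E i * indicator (cball 0 (1 / 2 ^ i)) h)" by (rule term_le_suminf)
        finally show ?thesis .
      qed simp
    qed
  qed
  also have "\<dots> = (\<Sum>i. E i * emeasure lborel (cball (0 :: 'a \<times> 'b) (1 / 2 ^ i)))"
    by (subst nn_integral_suminf)
      (simp_all add: nn_integral_cmult_indicator borel_measurable_times_ennreal borel_measurable_indicator)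
  also have "\<dots> = (\<Sum>i. ennreal (D * 2 ^ N * unit_ball_vol (real N)) * shell_sum \<rho> i)"
  proof (intro suminf_cong)
    fix i
    have vol: "emeasure lborel (cball (0 :: 'a \<times> 'b) (1 / 2 ^ i)) = ennreal (unit_ball_vol (real N) * (1 / 2 ^ i) ^ N)"
      unfolding N_def by (rule emeasure_cball) simp
    have cancel: "D * (2 ^ Suc i) ^ N * (unit_ball_vol (real N) * (1 / 2 ^ i) ^ N) = D * 2 ^ N * unit_ball_vol (real N)"
      by (simp add: power_mult_distrib power_one_over)
    have assoc: "ennreal A * S * ennreal V = ennreal (A * V) * S" if "A \<ge> 0" for A V S
      using that by (simp add: ennreal_mult' mult_ac)
    show "E i * emeasure lborel (cball (0 :: 'a \<times> 'b) (1 / 2 ^ i)) = ennreal (D * 2 ^ N * unit_ball_vol (real N)) * shell_sum \<rho> i"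
      unfolding E_def vol cancel[symmetric] using D by (intro assoc) simp
  qed
  also have "\<dots> = ennreal (D * 2 ^ N * unit_ball_vol (real N)) * (\<Sum>i. shell_sum \<rho> i)" by simp
  also have "\<dots> < \<infinity>" using suminf_shell_sum[OF \<open>\<rho> > 0\<close> sm] by (simp add: ennreal_mult_less_top)
  finally have "(\<integral>\<^sup>+h\<in>{h. norm h \<le> 1}. G h \<partial>lebesgue) < \<infinity>" .
  then have "ennpowr (\<integral>\<^sup>+h\<in>{h. norm h \<le> 1}. G h \<partial>lebesgue) (1 / Q) < \<infinity>"
    by (rule ennpowr_less_top)
  moreover have "besov_seminorm M s p q example = ennpowr (\<integral>\<^sup>+h\<in>{h. norm h \<le> 1}. G h \<partial>lebesgue) (1 / Q)"
    unfolding besov_seminorm_def G_def N_def Q_def q(2)[symmetric] using q(1) by (rule if_not_P)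
  ultimately show ?thesis by simp
qed

end

section \<open>A function whose slices all leave the Besov space\<close>

theorem theorem1p3:
  fixes N d M :: nat and p q :: ennreal and s :: real
  assumes "N \<ge> 2" and "1 \<le> d" and "d < N"
    and "DIM('a::euclidean_space) = d" and "DIM('b::euclidean_space) = N - d"
    and "0 < p" and "p < q" and "q \<le> \<infinity>"
    and "s > sigma_exp N p" and "real M > s"
  shows "\<exists>f :: 'a \<times> 'b \<Rightarrow> real.
           f \<in> besov_space M s p q \<and>
           (AE y in lebesgue. (\<lambda>x. f (x, y)) \<notin> besov_space M s p \<infinity>)"
proof -
  define P where "P = enn2real p"
  have p: "p \<noteq> \<infinity>" "p \<noteq> top" using \<open>p < q\<close> by (auto simp: less_top[symmetric])
  have P: "P > 0" unfolding P_def using \<open>0 < p\<close> p by (simp add: enn2real_positive_iff less_top)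
  have s: "0 < s" using \<open>s > sigma_exp N p\<close>
    by (rule le_less_trans[rotated]) (simp add: sigma_exp_def)
  \<comment> \<open>For \<open>q = \<infinity>\<close> any exponent greater than \<open>1\<close> makes the weights bounded.\<close>
  define \<rho> where "\<rho> = (if q = \<infinity> then 2 else enn2real q / P)"
  have \<rho>: "\<rho> > 1"
  proof (cases "q = \<infinity>")
    case False
    then have "P < enn2real q" unfolding P_def using \<open>p < q\<close> by (cases q; cases p) (auto simp: ennreal_less_iff)
    then show ?thesis using False P by (simp add: \<rho>_def)
  qed (simp add: \<rho>_def)
  obtain \<psi> K c where "cutoff M \<psi> K c"
    using cutoff_exists by blast
  moreover obtain \<eta> :: "nat \<Rightarrow> 'b" and r a :: "nat \<Rightarrow> real" where
    cubes: "\<forall>k. 0 < r k \<and> r k \<le> 1 \<and> 0 < a k"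
      "summable (\<lambda>k. (a k powr P * r k ^ DIM('b)) powr \<rho>)"
      "\<forall>y C. \<exists>k. C \<le> a k \<and> (\<forall>b\<in>Basis. (y - \<eta> k) \<bullet> b / r k \<in> {1/4..3/4})"
    using recurrent_cubes_exist[OF P \<rho>] by blast
  moreover obtain e0 :: 'a where "e0 \<in> Basis" using nonempty_Basis by blast
  ultimately interpret lacunary_atoms M \<psi> K c s P a r \<eta> e0
    using s P \<open>real M > s\<close> by (simp add: lacunary_atoms_def lacunary_atoms_axioms_def)
  have sm: "summable (\<lambda>k. weight k powr \<rho>)" using cubes(2) by (simp add: weight_def)
  obtain B where B: "\<And>k. weight k \<le> B"
  proof -
    have "weight k \<le> (\<Sum>k. weight k powr \<rho>) powr (1 / \<rho>)" for k
    proof -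
      have "weight k powr \<rho> \<le> (\<Sum>k. weight k powr \<rho>)"
        using sum_le_suminf[OF sm, of "{k}"] by simp
      then have "(weight k powr \<rho>) powr (1 / \<rho>) \<le> (\<Sum>k. weight k powr \<rho>) powr (1 / \<rho>)"
        using \<rho> by (intro powr_mono2) auto
      then show ?thesis using \<rho> weight_nonneg[of k] by (simp add: powr_powr)
    qed
    then show thesis by (rule that)
  qed
  have "besov_seminorm M s p q example < \<infinity>"
  proof (cases "q = \<infinity>")
    case True
    then show ?thesis using example_seminorm_infinity[OF p(1) P_def[symmetric] B] by simp
  next
    case False
    then have "enn2real q = P * \<rho>" using P by (simp add: \<rho>_def)
    then show ?thesis
      using \<rho> by (intro example_seminorm_finite[OF p(1) P_def[symmetric] False _ _ sm]) auto
  qed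
  then have "example \<in> besov_space M s p q"
    using example_Lp[OF p(1) P_def[symmetric] B] by (simp add: besov_space_def)
  moreover have "(\<lambda>x. example (x, y)) \<notin> besov_space M s p \<infinity>" for y
    by (rule slice_not_besov[OF p(1) P_def[symmetric] cubes(3)[rule_format]])
  ultimately show ?thesis by (intro exI[of _ example]) simp
qed

end
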